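(* There is an algorithm that, given documents $T_1,\dots,T_m$ of total length $n$ over $\Sigma=\{1,\dots,\sigma\}$, an integer $d$ with $2\le d\le m$, and a parameter $\tau$ with $1\le \tau\le n$, runs in $\mathcal{O}(n^2/\tau)$ time and $\mathcal{O}(1)$ space and outputs a string which is a substring of at least $d$ of the documents and has length at least $|LCS|-\tau+1$.
   Context: Longest common substring (LCS) problem: given $m$ strings (documents) $T_1,\dots,T_m$ over an integer alphabet $\Sigma=\{1,2,\dots,\sigma\}$ with $\sigma=n^{\mathcal{O}(1)}$, where $n=\sum_i|T_i|$, and an integer $2\le d\le m$, $LCS$ denotes a longest string that occurs as a substring in at least $d$ of the documents, and $|LCS|$ is its length. Model: word-RAM with word size $w=\Theta(\log n)$ bits; space is measured in machine words (input is read-only and not counted). An output string is reported as a pair of integers specifying a substring of the input. *)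

theory Defs
  imports Complex_Main "HOL-Library.Sublist"
begin

definition occurs_in_at_least :: "nat \<Rightarrow> nat list list \<Rightarrow> nat list \<Rightarrow> bool" where
  "occurs_in_at_least d Ts s \<longleftrightarrow> card {i. i < length Ts \<and> sublist s (Ts ! i)} \<ge> d"

definition lcs_len :: "nat \<Rightarrow> nat list list \<Rightarrow> nat" where
  "lcs_len d Ts = Max {length s | s. occurs_in_at_least d Ts s}"

text \<open>Registers are addressed only by constants written in the program (no indirect
 addressing, no writable memory array), so a program uses O(1) words of working space.
 The read-only input consists of the documents Ts (0-indexed), d and tau.\<close>

datatype instr =
    LoadConst nat nat
  | Add nat nat nat
  | Sub nat nat nat              (* r := a - b (truncated) *)
  | Mul nat nat nat
  | Div nat nat nat              (* division by 0 gives 0 *)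
  | Mod nat nat nat
  | Less nat nat nat
  | Eq nat nat nat
  | Jmp nat
  | JmpZ nat nat
  | InM nat
  | InD nat
  | InTau nat
  | InLen nat nat
  | InChr nat nat nat
  | Halt

type_synonym config = "nat \<times> (nat \<Rightarrow> nat)"

definition halted :: "instr list \<Rightarrow> config \<Rightarrow> bool" where
  "halted P c \<longleftrightarrow> fst c \<ge> length P \<or> P ! fst c = Halt"

definition doc_len :: "nat list list \<Rightarrow> nat \<Rightarrow> nat" where
  "doc_len Ts i = (if i < length Ts then length (Ts ! i) else 0)"

definition doc_chr :: "nat list list \<Rightarrow> nat \<Rightarrow> nat \<Rightarrow> nat" where
  "doc_chr Ts i j = (if i < length Ts \<and> j < length (Ts ! i) then Ts ! i ! j else 0)"

fun exec_instr :: "nat list list \<Rightarrow> nat \<Rightarrow> nat \<Rightarrow> instr \<Rightarrow> config \<Rightarrow> config" where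
  "exec_instr Ts d tau (LoadConst r k) (pc, R) = (Suc pc, R(r := k))"
| "exec_instr Ts d tau (Add r a b) (pc, R) = (Suc pc, R(r := R a + R b))"
| "exec_instr Ts d tau (Sub r a b) (pc, R) = (Suc pc, R(r := R a - R b))"
| "exec_instr Ts d tau (Mul r a b) (pc, R) = (Suc pc, R(r := R a * R b))"
| "exec_instr Ts d tau (Div r a b) (pc, R) = (Suc pc, R(r := R a div R b))"
| "exec_instr Ts d tau (Mod r a b) (pc, R) = (Suc pc, R(r := R a mod R b))"
| "exec_instr Ts d tau (Less r a b) (pc, R) = (Suc pc, R(r := (if R a < R b then 1 else 0)))"
| "exec_instr Ts d tau (Eq r a b) (pc, R) = (Suc pc, R(r := (if R a = R b then 1 else 0)))"
| "exec_instr Ts d tau (Jmp t) (pc, R) = (t, R)"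
| "exec_instr Ts d tau (JmpZ a t) (pc, R) = ((if R a = 0 then t else Suc pc), R)"
| "exec_instr Ts d tau (InM r) (pc, R) = (Suc pc, R(r := length Ts))"
| "exec_instr Ts d tau (InD r) (pc, R) = (Suc pc, R(r := d))"
| "exec_instr Ts d tau (InTau r) (pc, R) = (Suc pc, R(r := tau))"
| "exec_instr Ts d tau (InLen r a) (pc, R) = (Suc pc, R(r := doc_len Ts (R a)))"
| "exec_instr Ts d tau (InChr r a b) (pc, R) = (Suc pc, R(r := doc_chr Ts (R a) (R b)))"
| "exec_instr Ts d tau Halt (pc, R) = (pc, R)"

definition step :: "instr list \<Rightarrow> nat list list \<Rightarrow> nat \<Rightarrow> nat \<Rightarrow> config \<Rightarrow> config" where
  "step P Ts d tau c = (if halted P c then c else exec_instr Ts d tau (P ! fst c) c)"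

definition run :: "instr list \<Rightarrow> nat list list \<Rightarrow> nat \<Rightarrow> nat \<Rightarrow> nat \<Rightarrow> config" where
  "run P Ts d tau k = (step P Ts d tau ^^ k) (0, \<lambda>_. 0)"

end

theory Submission
  imports Defs
begin

text \<open>
  Put \<open>a = (tau + 1) div 2\<close> and \<open>b = tau + 1 - a\<close>. Only substrings that start at a multiple of \<open>a\<close> inside a document
  and whose length is a multiple of \<open>b\<close> are considered: rounding the start loses at most \<open>a - 1\<close> letters and rounding the
  length at most \<open>b - 1\<close>, together \<open>tau - 1\<close>. Scan the starts while keeping the best length \<open>l\<close> found so far; at each
  start test whether the pattern of length \<open>l + b\<close> occurs in \<open>d\<close> documents, increase \<open>l\<close> by \<open>b\<close> if it does, and go to
  the next start otherwise. Starts at which the pattern does not fit into its document are never tested, so (as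
  \<open>a \<le> b\<close>) there are at most \<open>n / a + n / b\<close> tests, and it remains to do one test in time \<open>O(n)\<close> and constant space.

  A test runs a variant of Crochemore's string matching on ordered alphabets. While the prefix \<open>x[0..i)\<close> of the
  pattern matches, Duval's method maintains its maximal suffix \<open>x[s..i)\<close> and the period \<open>p\<close> of that suffix. By maximality, every
  period of the prefix exceeds \<open>s\<close> and is at least \<open>p\<close>, and exceeds \<open>i - s - p\<close> unless \<open>s < p\<close> and the prefix itself has
  period \<open>p\<close>. So at a mismatch either one shifts by \<open>p\<close> and keeps \<open>i - p\<close> matched letters together with the
  maximal suffix, or one shifts by more than \<open>i / 3\<close> and starts afresh; both are paid for by the length of the shift.
\<close>

section \<open>Maximal suffixes and periods\<close>

text \<open>The comparison must be decided by a mismatch before \<open>N\<close>; a proper prefix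
  counts as neither smaller nor larger. This is why a verdict survives when the prefix
  grows.\<close>

definition mless :: "(nat \<Rightarrow> nat) \<Rightarrow> nat \<Rightarrow> nat \<Rightarrow> nat \<Rightarrow> bool" where
  "mless x N a b \<longleftrightarrow> (\<exists>r. a + r < N \<and> b + r < N \<and> x (a + r) < x (b + r) \<and> (\<forall>r'<r. x (a + r') = x (b + r')))"

text \<open>
  For \<open>h = N\<close> the state says that \<open>x[s..N)\<close> is the maximal suffix of \<open>x[0..N)\<close> and has least period \<open>p\<close>. For
  \<open>h < N\<close> the scan of the suffix starting at \<open>s\<close> has only reached \<open>h\<close>, but the earlier starting positions are
  already refuted by letters below \<open>N\<close>; this is what makes restarting the scan after a larger letter sound.
\<close>

definition max_suffix_state :: "(nat \<Rightarrow> nat) \<Rightarrow> nat \<Rightarrow> nat \<Rightarrow> nat \<Rightarrow> nat \<Rightarrow> bool" where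
  "max_suffix_state x N s p h \<longleftrightarrow> 1 \<le> p \<and> s + p \<le> h \<and> h \<le> N \<and>
     (\<forall>q. s \<le> q \<and> q + p < h \<longrightarrow> x (q + p) = x q) \<and>
     (\<forall>t. 0 < t \<and> t < p \<longrightarrow> mless x (s + p) (s + t) s) \<and>
     (\<forall>t<s. mless x N t s)"

lemma mless_mono: "mless x N a b \<Longrightarrow> N \<le> N' \<Longrightarrow> mless x N' a b"
  unfolding mless_def by (meson order_less_le_trans)

lemma mless_trans:
  assumes "mless x N a b" "mless x N b c" shows "mless x N a c"
proof -
  obtain r where r: "a + r < N" "b + r < N" "x (a + r) < x (b + r)" "\<forall>r'<r. x (a + r') = x (b + r')"
    using assms(1) unfolding mless_def by blast
  obtain u where u: "b + u < N" "c + u < N" "x (b + u) < x (c + u)" "\<forall>r'<u. x (b + r') = x (c + r')"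
    using assms(2) unfolding mless_def by blast
  have "a + min r u < N \<and> c + min r u < N" using r u by auto
  moreover have "x (a + min r u) < x (c + min r u)"
    by (cases r u rule: linorder_cases) (use r u in \<open>auto simp: min_def\<close>)
  moreover have "\<forall>r'<min r u. x (a + r') = x (c + r')" using r u by auto
  ultimately show ?thesis unfolding mless_def by blast
qed

lemma max_suffix_state_mono:
  "max_suffix_state x N s p h \<Longrightarrow> N \<le> N' \<Longrightarrow> max_suffix_state x N' s p h"
  unfolding max_suffix_state_def by (auto intro: mless_mono)

lemma max_suffix_state_init: "max_suffix_state x 1 0 1 1"
  unfolding max_suffix_state_def by auto

lemma max_suffix_state_periodic:
  assumes D: "max_suffix_state x N s p h" and "s + q + c * p < h"
  shows "x (s + q + c * p) = x (s + q)"
  using assms(2)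
proof (induction c)
  case (Suc c)
  have "s \<le> s + q + c * p" "s + q + c * p + p < h" using Suc.prems by auto
  then have "x (s + q + c * p + p) = x (s + q + c * p)"
    using D unfolding max_suffix_state_def by blast
  then show ?case using Suc by (simp add: algebra_simps)
qed simp

lemma max_suffix_state_mod:
  assumes D: "max_suffix_state x N s p h" and "s + q < h"
  shows "x (s + q) = x (s + q mod p)"
  using max_suffix_state_periodic[OF D, of "q mod p" "q div p"] assms(2) by (simp add: algebra_simps)

lemma max_suffix_state_cong:
  assumes D: "max_suffix_state x N s p h" and "s + q < h" "s + q' < h" "q mod p = q' mod p"
  shows "x (s + q) = x (s + q')"
  using max_suffix_state_mod[OF D] assms by metis

lemma max_suffix_state_eq:
  assumes D: "max_suffix_state x N s p h" and "h < N" "x h = x (h - p)"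
  shows "max_suffix_state x N s p (Suc h)"
proof -
  have "x (q + p) = x q" if "s \<le> q" "q + p < Suc h" for q
  proof (cases "q + p = h")
    case True
    then show ?thesis using assms(3) by auto
  next
    case False
    then show ?thesis using D that unfolding max_suffix_state_def by auto
  qed
  then show ?thesis using D assms(2) unfolding max_suffix_state_def by auto
qed

text \<open>The period reduces \<open>t\<close> to \<open>u = t mod p\<close>. If
  \<open>u = 0\<close>, both suffixes agree until the smaller letter at \<open>h\<close> decides.
  Otherwise the mismatch inside the first period decides, unless \<open>h\<close> is reached first,
  and then the smaller letter decides as well.\<close>

lemma mless_at_end:
  assumes D: "max_suffix_state x N s p h" and t: "0 < t" "s + t \<le> h" and less: "x h < x (h - p)"
  shows "mless x (Suc h) (s + t) s"
proof -
  define r where "r = h - s - t"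
  have ph: "1 \<le> p" "s + p \<le> h" using D unfolding max_suffix_state_def by auto
  have sr: "s + t + r = h" using t r_def by auto
  define u where "u = t mod p"
  have up: "u < p" using ph u_def by auto
  have xh: "x (h - p) = x (s + (u + r) mod p)"
  proof -
    have "h - p = s + (t + r - p)" using sr ph by auto
    moreover have "(t + r - p) mod p = (t + r) mod p" using sr ph by (simp add: le_mod_geq)
    moreover have "(t + r) mod p = (u + r) mod p" unfolding u_def by (simp add: mod_add_left_eq)
    ultimately show ?thesis using max_suffix_state_mod[OF D, of "t + r - p"] ph by auto
  qed
  show ?thesis
  proof (cases "u = 0")
    case True
    have "x (s + t + r') = x (s + r')" if "r' < r" for r'
    proof -
      have "(t + r') mod p = r' mod p" using True unfolding u_def by (metis add_0 mod_add_left_eq)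
      then show ?thesis using max_suffix_state_cong[OF D, of "t + r'" r'] that sr by (auto simp: add.assoc)
    qed
    moreover have "x (h - p) = x (s + r)"
      using xh True max_suffix_state_mod[OF D, of r] sr t by auto
    ultimately show ?thesis unfolding mless_def using sr t less
      by (intro exI[of _ r]) auto
  next
    case False
    then have "mless x (s + p) (s + u) s"
      using D up unfolding max_suffix_state_def by auto
    then obtain v where v: "s + u + v < s + p" "x (s + u + v) < x (s + v)" "\<forall>r'<v. x (s + u + r') = x (s + r')"
      unfolding mless_def by auto
    have tu: "x (s + t + r') = x (s + u + r')" if "u + r' < p" "r' < r" for r'
    proof -
      have "(t + r') mod p = (u + r') mod p" unfolding u_def by (simp add: mod_add_left_eq)
      moreover have "s + (t + r') < h" "s + (u + r') < h" using that sr ph by auto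
      ultimately show ?thesis using max_suffix_state_cong[OF D] by (metis add.assoc)
    qed
    show ?thesis
    proof (cases "v < r")
      case True
      then show ?thesis unfolding mless_def using v tu sr t
        by (intro exI[of _ v]) auto
    next
      case False
      then have "u + r < p" using v by auto
      then have "x h < x (s + u + r)" using xh less by (simp add: add.assoc)
      also have "x (s + u + r) \<le> x (s + r)" using v False by (cases "r = v") auto
      finally show ?thesis unfolding mless_def using v tu sr t False
        by (intro exI[of _ r]) auto
    qed
  qed
qed

text \<open>The smaller letter refutes every later start, so no period shorter than the whole
  scanned piece is left.\<close>

lemma max_suffix_state_less:
  assumes D: "max_suffix_state x N s p h" and "h < N" "x h < x (h - p)"
  shows "max_suffix_state x N s (Suc h - s) (Suc h)"
proof -
  have "mless x (Suc h) (s + t) s" if "0 < t" "t < Suc h - s" for t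
    using mless_at_end[OF D, of t] that assms(3) by auto
  then show ?thesis using D assms(2) unfolding max_suffix_state_def by auto
qed

text \<open>The larger letter makes the incomplete last period, starting at \<open>s'\<close>, beat
  all starts in the complete periods before it; starts before \<open>s\<close> lose to
  \<open>s\<close> and hence to \<open>s'\<close>. Nothing is known about starts after
  \<open>s'\<close>, so the scan goes back to \<open>Suc s'\<close>.\<close>

lemma max_suffix_state_greater:
  assumes D: "max_suffix_state x N s p h" and hN: "h < N" and gr: "x (h - p) < x h"
  defines "s' \<equiv> h - (h - s) mod p"
  shows "max_suffix_state x N s' 1 (Suc s')"
proof -
  define r where "r = (h - s) mod p"
  have ph: "1 \<le> p" "s + p \<le> h" using D unfolding max_suffix_state_def by auto
  have rp: "r < p" using ph r_def by auto
  have rh: "r \<le> h - s" unfolding r_def by simp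
  define c where "c = (h - s) div p"
  have hs: "h - s = c * p + r" unfolding c_def r_def by simp
  have s': "s' = s + c * p" "s' + r = h" using hs ph rh unfolding s'_def r_def[symmetric] by auto
  have xh: "x (h - p) = x (s + r)"
  proof -
    have "h - p = s + (c * p + r - p)" using hs ph by auto
    moreover have "(c * p + r - p) mod p = r"
      using rp ph hs le_mod_geq[of p "c * p + r"] by simp
    ultimately show ?thesis using max_suffix_state_mod[OF D, of "c * p + r - p"] ph by auto
  qed
  have "c \<noteq> 0" using hs ph rp by (intro notI) simp
  then have c1: "p \<le> c * p" by simp
  have main: "mless x N (s + t) s'" if t: "t < c * p" for t
  proof -
    define u where "u = t mod p"
    have up: "u < p" using ph u_def by auto
    \<comment> \<open>The period block containing \<open>t\<close> ends by \<open>c * p\<close>, so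
      comparisons that stay inside a block read only letters before \<open>h\<close>.\<close>
    have tle: "(t - u) + p \<le> c * p"
    proof -
      have "t div p < c" using t ph by (simp add: less_mult_imp_div_less)
      then have "(t div p + 1) * p \<le> c * p" by (intro mult_le_mono1) auto
      then show ?thesis unfolding u_def by (simp add: minus_mod_eq_div_mult algebra_simps)
    qed
    have tu: "x (s + t + r') = x (s + u + r')" if "u + r' < p" for r'
    proof -
      have "(t + r') mod p = (u + r') mod p" unfolding u_def by (simp add: mod_add_left_eq)
      moreover have "u \<le> t" unfolding u_def by simp
      then have "s + (t + r') < h" "s + (u + r') < h" using that tle s' ph by auto
      ultimately show ?thesis using max_suffix_state_cong[OF D] by (metis add.assoc)
    qed
    have sr: "x (s' + r') = x (s + r')" if "r' < r" for r'
      using max_suffix_state_periodic[OF D, of r' c] that s' by (simp add: algebra_simps)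
    have xsr: "x (s + r) < x (s' + r)" using xh gr s' by simp
    show ?thesis
    proof (cases "u = 0")
      case True
      show ?thesis unfolding mless_def
        using True tu[of r] rp xsr sr tu s' hN t by (intro exI[of _ r]) auto
    next
      case False
      then have "mless x (s + p) (s + u) s"
        using D up unfolding max_suffix_state_def by auto
      then obtain v where v: "s + u + v < s + p" "x (s + u + v) < x (s + v)" "\<forall>r'<v. x (s + u + r') = x (s + r')"
        unfolding mless_def by auto
      show ?thesis
      proof (cases "v < r")
        case True
        then show ?thesis unfolding mless_def using v tu sr s' hN t
          by (intro exI[of _ v]) auto
      next
        case False
        have "x (s + t + r) = x (s + u + r)" using tu False v by auto
        also have "x (s + u + r) \<le> x (s + r)" using v False by (cases "r = v") auto
        finally show ?thesis unfolding mless_def using v tu sr s' hN t False xsr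
          by (intro exI[of _ r]) auto
      qed
    qed
  qed
  have "mless x N t s'" if "t < s'" for t
  proof (cases "t < s")
    case True
    then have "mless x N t s" using D unfolding max_suffix_state_def by auto
    moreover have "mless x N s s'" using main[of 0] c1 ph by auto
    ultimately show ?thesis by (rule mless_trans)
  next
    case False
    then show ?thesis using main[of "t - s"] that s' by auto
  qed
  then show ?thesis unfolding max_suffix_state_def using s' hN gr rp
    by (cases "r = 0") (auto simp: Suc_le_eq)
qed

section \<open>Periods of the prefix against the period of its maximal suffix\<close>

definition is_period :: "(nat \<Rightarrow> nat) \<Rightarrow> nat \<Rightarrow> nat \<Rightarrow> bool" where
  "is_period x N q \<longleftrightarrow> 0 < q \<and> (\<forall>t. t + q < N \<longrightarrow> x t = x (t + q))"

text \<open>A period \<open>q \<le> s\<close> would copy the suffix at \<open>s\<close> onto the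
  start \<open>s - q\<close>, which maximality has refuted by a mismatch.\<close>

lemma period_gt_start:
  assumes D: "max_suffix_state x N s p N" and q: "is_period x N q"
  shows "s < q"
proof (rule ccontr)
  assume "\<not> s < q"
  then have "s - q < s" "s - q + q = s" using q unfolding is_period_def by auto
  then obtain r where "s + r < N" "x (s - q + r) < x (s + r)"
    using D unfolding max_suffix_state_def mless_def by blast
  moreover have "x (s - q + r) = x (s - q + r + q)"
    using q \<open>s - q + q = s\<close> \<open>s + r < N\<close> unfolding is_period_def by (auto simp: algebra_simps)
  ultimately show False using \<open>s - q + q = s\<close> by (simp add: algebra_simps)
qed

text \<open>The block \<open>x[s..s+p)\<close> is unbordered: each shift inside it is refuted by a
  mismatch within the block.\<close>

lemma no_border:
  assumes D: "max_suffix_state x N s p h" and "0 < t" "\<And>r. t + r < p \<Longrightarrow> x (s + t + r) = x (s + r)"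
  shows "p \<le> t"
proof (rule ccontr)
  assume "\<not> p \<le> t"
  then have "mless x (s + p) (s + t) s" using D assms(2) unfolding max_suffix_state_def by auto
  then show False using assms(3) unfolding mless_def by fastforce
qed

lemma period_ge:
  assumes D: "max_suffix_state x N s p N" and q: "is_period x N q"
  shows "p \<le> q"
proof (rule no_border[OF D])
  show "0 < q" using q unfolding is_period_def by auto
  show "x (s + q + r) = x (s + r)" if "q + r < p" for r
    using q D that unfolding is_period_def max_suffix_state_def by (auto simp: algebra_simps)
qed

text \<open>Shifted by \<open>q\<close>, the suffix still overlaps itself in \<open>p\<close>
  letters, so \<open>q mod p\<close> would give a border of the unbordered block unless
  \<open>p\<close> divides \<open>q\<close>. Then letters less than \<open>p\<close> before
  \<open>s\<close> also repeat with \<open>p\<close>, and \<open>s \<ge> p\<close> would give an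
  earlier start agreeing with the maximal suffix.\<close>

lemma short_period:
  assumes D: "max_suffix_state x N s p N" and q: "is_period x N q" and short: "s + q + p \<le> N"
  shows "s < p" "\<forall>t<s. x t = x (t + p)"
proof -
  have sq: "s < q" using period_gt_start[OF D q] .
  have ph: "1 \<le> p" "s + p \<le> N" using D unfolding max_suffix_state_def by auto
  have q0: "0 < q" and qp: "\<And>t. t + q < N \<Longrightarrow> x t = x (t + q)" using q unfolding is_period_def by auto
  have dv: "q mod p = 0"
  proof (rule ccontr)
    assume nz: "q mod p \<noteq> 0"
    have "x (s + q mod p + r) = x (s + r)" if r: "q mod p + r < p" for r
    proof -
      have "x (s + (q mod p + r)) = x (s + (q + r))"
        using max_suffix_state_cong[OF D, of "q mod p + r" "q + r"] r short ph
        by (auto simp: mod_add_left_eq)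
      also have "\<dots> = x (s + r)" using qp[of "s + r"] r short by (auto simp: algebra_simps)
      finally show ?thesis by (simp add: algebra_simps)
    qed
    from no_border[OF D _ this] nz have "p \<le> q mod p" by auto
    then show False using ph by (simp add: linorder_not_less[symmetric])
  qed
  have left: "x t = x (t + p)" if t: "t < s" "s \<le> t + p" for t
  proof -
    have "x t = x (s + (t + q - s))" using qp[of t] t short sq by auto
    also have "\<dots> = x (s + (t + p - s))"
    proof (rule max_suffix_state_cong[OF D])
      \<comment> \<open>Adding \<open>s - t\<close> turns the two differences into \<open>q\<close>
        and \<open>p\<close>, both multiples of \<open>p\<close>.\<close>
      have "t + q - s + (s - t) = q" using t sq by auto
      moreover have "t + p - s + (s - t) = p" using t by auto
      ultimately have "(t + q - s + (s - t)) mod p = (t + p - s + (s - t)) mod p" using dv by simp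
      then show "(t + q - s) mod p = (t + p - s) mod p" by (simp add: nat_mod_eq_iff)
    qed (use t short sq in auto)
    finally show ?thesis using t by simp
  qed
  show "s < p"
  proof (rule ccontr)
    assume a: "\<not> s < p"
    then have "s - p < s" "s - p + p = s" using ph by auto
    then obtain r where r: "s + r < N" "x (s - p + r) < x (s + r)"
      using D unfolding max_suffix_state_def mless_def by blast
    have "x (s - p + r) = x (s + r)"
    proof (cases "r < p")
      case True
      then show ?thesis using left[of "s - p + r"] a by auto
    next
      case False
      then show ?thesis using max_suffix_state_cong[OF D, of "r - p" r] r a ph by (auto simp: le_mod_geq)
    qed
    then show False using r by simp
  qed
  then show "\<forall>t<s. x t = x (t + p)" using left by auto
qed

text \<open>As \<open>q\<close> exceeds \<open>s\<close> and is at least \<open>p\<close>, both ways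
  to fail give \<open>N < 3 * q\<close>: either the overlap is too short,
  \<open>N < s + q + p\<close>, or the suffix has fewer than two periods,
  \<open>N < s + 2 * p\<close> with \<open>s < p\<close>.\<close>

lemma long_period:
  assumes D: "max_suffix_state x N s p N" and q: "is_period x N q"
    and "\<not> (s < p \<and> (\<forall>t<s. x t = x (t + p)) \<and> 2 * p \<le> N - s)"
  shows "N div 3 < q"
proof -
  have "s < q" "p \<le> q" using period_gt_start[OF D q] period_ge[OF D q] .
  moreover have "s + p \<le> N" "1 \<le> p" using D unfolding max_suffix_state_def by auto
  moreover have "s < p \<and> N - s < 2 * p \<or> N < s + q + p"
    using short_period[OF D q] assms(3) by force
  ultimately show ?thesis by linarith
qed

text \<open>A start \<open>t < s\<close> reappears at \<open>t + p\<close> inside the first period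
  after \<open>s\<close>, where it was refuted. The letters read from there lie before
  \<open>s + p\<close> and can be moved back by \<open>p\<close>; two full periods keep everything
  below \<open>N - p\<close>.\<close>

lemma max_suffix_state_shift:
  assumes D: "max_suffix_state x N s p N" and s: "s < p" "\<forall>t<s. x t = x (t + p)" "2 * p \<le> N - s"
  shows "max_suffix_state x (N - p) s p (N - p)"
proof -
  have "mless x (N - p) t s" if t: "t < s" for t
  proof -
    have "0 < t + p - s" "t + p - s < p" using t s(1) by auto
    then have "mless x (s + p) (s + (t + p - s)) s"
      using D unfolding max_suffix_state_def by blast
    then obtain r where r: "t + p + r < s + p" "x (t + p + r) < x (s + r)" "\<forall>r'<r. x (t + p + r') = x (s + r')"
      using t s(1) unfolding mless_def by auto
    have "x (t + p + r') = x (t + r')" if "r' \<le> r" for r'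
      using s(2) r(1) that by (auto simp: algebra_simps)
    then show ?thesis unfolding mless_def using r s t by (intro exI[of _ r]) auto
  qed
  moreover have "\<forall>q. s \<le> q \<and> q + p < N - p \<longrightarrow> x (q + p) = x q"
    using D unfolding max_suffix_state_def by auto
  ultimately show ?thesis using D s unfolding max_suffix_state_def by auto
qed

section \<open>Matching in constant space\<close>

definition occ :: "(nat \<Rightarrow> nat) \<Rightarrow> (nat \<Rightarrow> nat) \<Rightarrow> nat \<Rightarrow> nat \<Rightarrow> nat \<Rightarrow> bool" where
  "occ x y m N j \<longleftrightarrow> j + m \<le> N \<and> (\<forall>q<m. x q = y (j + q))"

text \<open>
  The pattern \<open>x\<close> of length \<open>m\<close> is aligned with position \<open>j\<close> of the text \<open>y\<close> of length \<open>N\<close> and its first \<open>i\<close>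
  letters match. The maximal suffix is known for the prefix of length \<open>h\<close> only, which may lag behind \<open>i\<close>.
\<close>

definition match_inv where
  "match_inv x y m N j i s p h \<longleftrightarrow> j + i \<le> N \<and> i \<le> m \<and> (\<forall>q<i. x q = y (j + q)) \<and>
     max_suffix_state x (max i 1) s p h \<and> (\<forall>j'<j. \<not> occ x y m N j')"

lemma match_inv_bounds:
  assumes "match_inv x y m N j i s p h"
  shows "j + i \<le> N" "i \<le> m" "1 \<le> p" "s + p \<le> h" "h \<le> max i 1"
  using assms unfolding match_inv_def max_suffix_state_def by auto

lemma match_inv_init: "match_inv x y m N 0 0 0 1 1"
  unfolding match_inv_def using max_suffix_state_init by auto

lemma match_inv_found: "match_inv x y m N j m s p h \<Longrightarrow> occ x y m N j"
  unfolding match_inv_def occ_def by auto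

lemma match_inv_not_found: "match_inv x y m N j i s p h \<Longrightarrow> N \<le> j + i \<Longrightarrow> i < m \<Longrightarrow> \<not> occ x y m N j'"
  unfolding match_inv_def occ_def by (cases "j' < j") auto

lemma match_inv_extend:
  assumes "match_inv x y m N j i s p h" "i < m" "j + i < N" "x i = y (j + i)"
  shows "match_inv x y m N j (Suc i) s p h"
  using assms max_suffix_state_mono[of x "max i 1" s p h "max (Suc i) 1"]
  unfolding match_inv_def by (auto simp: less_Suc_eq)

lemma match_inv_eq:
  assumes "match_inv x y m N j i s p h" "h < i" "x h = x (h - p)"
  shows "match_inv x y m N j i s p (Suc h)"
  using assms max_suffix_state_eq[of x "max i 1" s p h] unfolding match_inv_def by auto

lemma match_inv_less:
  assumes "match_inv x y m N j i s p h" "h < i" "x h < x (h - p)"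
  shows "match_inv x y m N j i s (Suc h - s) (Suc h)"
  using assms max_suffix_state_less[of x "max i 1" s p h] unfolding match_inv_def by auto

lemma match_inv_greater:
  assumes "match_inv x y m N j i s p h" "h < i" "x (h - p) < x h"
  shows "match_inv x y m N j i (h - (h - s) mod p) 1 (Suc (h - (h - s) mod p))"
  using assms max_suffix_state_greater[of x "max i 1" s p h] unfolding match_inv_def by auto

text \<open>Where the two alignments overlap, both equal the text, so their distance is a period of
  the matched prefix; distance 0 is excluded by the mismatch.\<close>

lemma occ_shift_period:
  assumes "match_inv x y m N j i s p h" "i < m" "x i \<noteq> y (j + i)" "occ x y m N j'" "j' < j + i"
  shows "is_period x i (j' - j) \<and> j < j'"
proof -
  have le: "j \<le> j'" using assms unfolding match_inv_def by (meson not_le)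
  moreover have "j' \<noteq> j" using assms unfolding occ_def by auto
  ultimately have lt: "j < j'" by simp
  have "x t = x (t + (j' - j))" if "t + (j' - j) < i" for t
  proof -
    have "x t = y (j' + t)" using assms(2,4) that unfolding occ_def by auto
    also have "\<dots> = x (t + (j' - j))" using assms(1) that lt unfolding match_inv_def
      by (auto simp: algebra_simps)
    finally show ?thesis .
  qed
  then show ?thesis using lt unfolding is_period_def by auto
qed

lemma match_inv_shift:
  assumes M: "match_inv x y m N j i s p h" and h: "i \<le> h" and mis: "i < m" "x i \<noteq> y (j + i)"
    and s: "s < p" "\<forall>t<s. x t = x (t + p)" "2 * p \<le> h - s"
  shows "match_inv x y m N (j + p) (i - p) s p (h - p)" "2 * p \<le> i"
proof -
  note b = match_inv_bounds[OF M]
  \<comment> \<open>\<open>h\<close> can exceed \<open>i\<close> only for \<open>i = 0\<close>,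
    \<open>h = 1\<close>; two periods in \<open>h - s\<close> rule that out.\<close>
  have hi: "h = i" "1 \<le> i" using b s h by auto
  then have D: "max_suffix_state x i s p i" using M unfolding match_inv_def by (simp add: max_absorb1)
  show i2: "2 * p \<le> i" using s hi by auto
  have "max_suffix_state x (max (i - p) 1) s p (h - p)"
    using max_suffix_state_shift[OF D s(1,2)] s(3) hi i2 b(3) by (simp add: max_absorb1)
  moreover have "\<not> occ x y m N j'" if "j' < j + p" for j'
  proof
    assume o: "occ x y m N j'"
    then have "is_period x i (j' - j) \<and> j < j'" using occ_shift_period[OF M mis] that i2 by auto
    then have "p \<le> j' - j" using period_ge[OF D] by blast
    then show False using that b(3) by linarith
  qed
  moreover have "x q = y (j + p + q)" if "q < i - p" for q
  proof (cases "q < s")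
    case True
    then have "x q = x (q + p)" using s by auto
    then show ?thesis using M that unfolding match_inv_def by (auto simp: algebra_simps)
  next
    case False
    then have "x (q + p) = x q" using D that unfolding max_suffix_state_def by auto
    moreover have "x (q + p) = y (j + (q + p))" using M that unfolding match_inv_def by auto
    ultimately show ?thesis by (simp add: algebra_simps)
  qed
  ultimately show "match_inv x y m N (j + p) (i - p) s p (h - p)"
    using b i2 unfolding match_inv_def by auto
qed

text \<open>A skipped occurrence would give a period of at most \<open>i div 3\<close>, against
  \<open>long_period\<close>. For \<open>i = 0\<close> the shift is 1 and skips only the alignment
  that failed at its first letter.\<close>

lemma match_inv_reset:
  assumes M: "match_inv x y m N j i s p h" and h: "i \<le> h" and mis: "i < m" "j + i < N" "x i \<noteq> y (j + i)"
    and ns: "\<not> (s < p \<and> (\<forall>t<s. x t = x (t + p)) \<and> 2 * p \<le> h - s)"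
  shows "match_inv x y m N (j + (i div 3 + 1)) 0 0 1 1"
proof -
  note b = match_inv_bounds[OF M]
  have "\<not> occ x y m N j'" if "j' < j + (i div 3 + 1)" for j'
  proof
    assume o: "occ x y m N j'"
    show False
    proof (cases "i = 0")
      case True
      then show ?thesis using o that M mis unfolding match_inv_def occ_def
        by (cases "j' = j") auto
    next
      case False
      then have hi: "h = i" using b h by auto
      then have D: "max_suffix_state x i s p i" using M False unfolding match_inv_def by (simp add: max_absorb1)
      have "j' < j + i \<or> i = 1 \<and> j' = j" using that False by linarith
      then have "j' < j + i" using False by auto
      then have "is_period x i (j' - j) \<and> j < j'" using occ_shift_period[OF M mis(1,3) o] by auto
      then have "i div 3 < j' - j" using long_period[OF D] ns hi by auto
      then show False using that by auto
    qed
  qed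
  then show ?thesis using max_suffix_state_init mis unfolding match_inv_def by auto
qed

section \<open>The program and its symbolic execution\<close>

text \<open>
  Registers 0 and 1 hold the output (global position and length \<open>l\<close>), 2 the number of documents, 3 \<open>d\<close>,
  4 and 5 the steps \<open>a\<close> and \<open>b\<close>; 6, 8, 9 the constants 1, 2, 3; 10 and 11 the document and offset where the
  current pattern starts, 12 the global position of that document, 13 its length, 14 the pattern length;
  15 the document searched, 16 the number of documents found to contain the pattern, 17 the length of the
  searched document; 18 to 22 the matching state \<open>j, i, s, p, h\<close> of \<open>match_inv\<close>; 23 the counter of the period
  test; 24 to 26 are scratch. The marginal numbers in the program are the addresses of the instructions next to them.
\<close>

definition prog :: "instr list" where
  "prog = [
    LoadConst 6 1, LoadConst 8 2, LoadConst 9 3, InM 2, InD 3, InTau 5, Add 5 5 6, Div 4 5 8, Sub 5 5 4,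
    \<comment> \<open>9\<close> Less 24 10 2, JmpZ 24 96, InLen 13 10, Add 14 1 5, Add 24 11 14, Less 24 13 24, JmpZ 24 20,
    Add 12 12 13, LoadConst 11 0, Add 10 10 6, Jmp 9,
    \<comment> \<open>20\<close> LoadConst 15 0, LoadConst 16 0,
    \<comment> \<open>22\<close> Less 24 15 2, JmpZ 24 89, InLen 17 15, LoadConst 18 0,
    \<comment> \<open>26\<close> LoadConst 19 0, LoadConst 20 0, LoadConst 21 1, LoadConst 22 1,
    \<comment> \<open>30\<close> Less 24 22 19, JmpZ 24 49, Add 24 11 22, InChr 25 10 24, Sub 24 24 21, InChr 26 10 24,
    Less 24 26 25, JmpZ 24 44, Sub 24 22 20, Mod 24 24 21, Sub 20 22 24, Add 22 20 6, LoadConst 21 1, Jmp 30,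
    \<comment> \<open>44\<close> Add 22 22 6, Less 24 25 26, JmpZ 24 30, Sub 21 22 20, Jmp 30,
    \<comment> \<open>49\<close> Less 24 19 14, JmpZ 24 86, Add 24 18 19, Less 25 24 17, JmpZ 25 87, InChr 25 15 24,
    Add 24 11 19, InChr 26 10 24, Eq 24 25 26, JmpZ 24 61, Add 19 19 6, Jmp 30,
    \<comment> \<open>61\<close> LoadConst 23 0, Less 24 20 21, JmpZ 24 78,
    \<comment> \<open>64\<close> Less 24 23 20, JmpZ 24 74, Add 24 11 23, InChr 25 10 24, Add 24 24 21, InChr 26 10 24,
    Eq 24 25 26, JmpZ 24 78, Add 23 23 6, Jmp 64,
    \<comment> \<open>74\<close> Sub 24 22 20, Sub 24 24 21, Less 24 24 21, JmpZ 24 82,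
    \<comment> \<open>78\<close> Div 24 19 9, Add 24 24 6, Add 18 18 24, Jmp 26,
    \<comment> \<open>82\<close> Add 18 18 21, Sub 19 19 21, Sub 22 22 21, Jmp 30,
    \<comment> \<open>86\<close> Add 16 16 6,
    \<comment> \<open>87\<close> Add 15 15 6, Jmp 22,
    \<comment> \<open>89\<close> Less 24 16 3, JmpZ 24 93, Add 11 11 4, Jmp 9,
    \<comment> \<open>93\<close> Add 1 1 5, Add 0 12 11, Jmp 9,
    \<comment> \<open>96\<close> Halt]"

lemma length_prog: "length prog = 97"
  by (simp add: prog_def)

section \<open>Total correctness with time and register bounds\<close>

locale ram =
  fixes Ts :: "nat list list" and d tau B :: nat and post :: "(nat \<Rightarrow> nat) \<Rightarrow> bool"
begin

definition bnd :: "(nat \<Rightarrow> nat) \<Rightarrow> bool" where "bnd R \<longleftrightarrow> (\<forall>r. R r \<le> B)"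

text \<open>Judgements are composed backwards from \<open>Halt\<close>, so \<open>k\<close> bounds
  the remaining time. Assuming \<open>bnd R\<close> here spares the loop invariants a bound on
  scratch registers.\<close>

definition ok :: "nat \<Rightarrow> nat \<Rightarrow> (nat \<Rightarrow> nat) \<Rightarrow> bool" where
  "ok k pc R \<longleftrightarrow> (bnd R \<longrightarrow> (\<exists>t\<le>k. let c = (step prog Ts d tau ^^ t) (pc, R) in
     halted prog c \<and> post (snd c) \<and> (\<forall>i\<le>t. bnd (snd ((step prog Ts d tau ^^ i) (pc, R))))))"

lemma ok_mono: "ok k pc R \<Longrightarrow> k \<le> k' \<Longrightarrow> ok k' pc R"
  unfolding ok_def by (meson order_trans)

lemma ok_stepI:
  assumes st: "step prog Ts d tau (pc, R) = (pc', R')"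
    and b: "bnd R \<Longrightarrow> bnd R'" and ok: "ok k pc' R'"
  shows "ok (Suc k) pc R"
  unfolding ok_def
proof
  assume R: "bnd R"
  from ok b[OF R] obtain t where t: "t \<le> k"
    "halted prog ((step prog Ts d tau ^^ t) (pc', R'))" "post (snd ((step prog Ts d tau ^^ t) (pc', R')))"
    "\<forall>i\<le>t. bnd (snd ((step prog Ts d tau ^^ i) (pc', R')))" unfolding ok_def Let_def by blast
  have sh: "(step prog Ts d tau ^^ Suc i) (pc, R) = (step prog Ts d tau ^^ i) (pc', R')" for i
    by (simp add: funpow_Suc_right st del: funpow.simps)
  have "bnd (snd ((step prog Ts d tau ^^ i) (pc, R)))" if "i \<le> Suc t" for i
    using that t(4) R sh by (cases i) (auto simp del: funpow.simps(2))
  then show "\<exists>t\<le>Suc k. let c = (step prog Ts d tau ^^ t) (pc, R) in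
     halted prog c \<and> post (snd c) \<and> (\<forall>i\<le>t. bnd (snd ((step prog Ts d tau ^^ i) (pc, R))))"
    using t sh unfolding Let_def by (intro exI[of _ "Suc t"]) (auto simp del: funpow.simps(2))
qed

lemma ok_halt: "post R \<Longrightarrow> ok k 96 R"
  unfolding ok_def Let_def by (auto simp: halted_def prog_def intro!: exI[of _ 0])

text \<open>A weakest precondition with continuation \<open>C\<close>; the extra conjunct keeps each
  new value within \<open>B\<close>, so the word size is verified along with the result.\<close>

fun exec_then :: "instr \<Rightarrow> (nat \<Rightarrow> (nat \<Rightarrow> nat) \<Rightarrow> bool) \<Rightarrow> nat \<Rightarrow> (nat \<Rightarrow> nat) \<Rightarrow> bool" where
  "exec_then (LoadConst r v) C pc R \<longleftrightarrow> v \<le> B \<and> C (Suc pc) (R(r := v))"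
| "exec_then (Add r a b) C pc R \<longleftrightarrow> R a + R b \<le> B \<and> C (Suc pc) (R(r := R a + R b))"
| "exec_then (Sub r a b) C pc R \<longleftrightarrow> R a - R b \<le> B \<and> C (Suc pc) (R(r := R a - R b))"
| "exec_then (Mul r a b) C pc R \<longleftrightarrow> R a * R b \<le> B \<and> C (Suc pc) (R(r := R a * R b))"
| "exec_then (Div r a b) C pc R \<longleftrightarrow> R a div R b \<le> B \<and> C (Suc pc) (R(r := R a div R b))"
| "exec_then (Mod r a b) C pc R \<longleftrightarrow> R a mod R b \<le> B \<and> C (Suc pc) (R(r := R a mod R b))"
| "exec_then (Less r a b) C pc R \<longleftrightarrow> 1 \<le> B \<and> C (Suc pc) (R(r := (if R a < R b then 1 else 0)))"
| "exec_then (Eq r a b) C pc R \<longleftrightarrow> 1 \<le> B \<and> C (Suc pc) (R(r := (if R a = R b then 1 else 0)))"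
| "exec_then (Jmp t) C pc R \<longleftrightarrow> C t R"
| "exec_then (JmpZ a t) C pc R \<longleftrightarrow> (if R a = 0 then C t R else C (Suc pc) R)"
| "exec_then (InM r) C pc R \<longleftrightarrow> length Ts \<le> B \<and> C (Suc pc) (R(r := length Ts))"
| "exec_then (InD r) C pc R \<longleftrightarrow> d \<le> B \<and> C (Suc pc) (R(r := d))"
| "exec_then (InTau r) C pc R \<longleftrightarrow> tau \<le> B \<and> C (Suc pc) (R(r := tau))"
| "exec_then (InLen r a) C pc R \<longleftrightarrow> doc_len Ts (R a) \<le> B \<and> C (Suc pc) (R(r := doc_len Ts (R a)))"
| "exec_then (InChr r a b) C pc R \<longleftrightarrow> doc_chr Ts (R a) (R b) \<le> B \<and> C (Suc pc) (R(r := doc_chr Ts (R a) (R b)))"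
| "exec_then Halt C pc R \<longleftrightarrow> False"

primrec execs :: "nat \<Rightarrow> nat \<Rightarrow> nat \<Rightarrow> (nat \<Rightarrow> nat) \<Rightarrow> bool" where
  "execs 0 k pc R = ok k pc R"
| "execs (Suc n) k pc R = (pc < 97 \<and> exec_then (prog ! pc) (execs n k) pc R)"

lemma execs_numeral [simp]:
  "execs (numeral v) k pc R = (pc < 97 \<and> exec_then (prog ! pc) (execs (pred_numeral v) k) pc R)"
  by (simp add: numeral_eq_Suc)

lemma exec_then_imp_ok:
  assumes "pc < 97" "exec_then (prog ! pc) C pc R" "\<And>pc' R'. C pc' R' \<Longrightarrow> ok k pc' R'"
  shows "ok (Suc k) pc R"
proof -
  have "prog ! pc \<noteq> Halt" using assms(2) by auto
  then have nh: "\<not> halted prog (pc, R)" using assms by (simp add: halted_def length_prog)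
  show ?thesis
    using assms(2)
    by (cases "prog ! pc")
       (auto intro!: ok_stepI assms(3) simp: step_def nh bnd_def split: if_splits)
qed

lemma execs_imp_ok_add: "execs n k pc R \<Longrightarrow> ok (k + n) pc R"
proof (induction n arbitrary: pc R)
  case (Suc n)
  then show ?case using exec_then_imp_ok[of pc "execs n k" R "k + n"] by auto
qed simp

lemma execs_imp_ok: "execs n k pc R \<Longrightarrow> k + n \<le> k' \<Longrightarrow> ok k' pc R"
  using execs_imp_ok_add ok_mono by blast

end

text \<open>Addresses and counters stay linear in \<open>n\<close>, but letters may be a larger
  power of \<open>n\<close>, hence the separate assumption \<open>chr_le\<close>.\<close>

locale ram_input = ram +
  fixes n
  assumes B: "4 * n + 10 \<le> B" and chr_le: "\<And>i j. doc_chr Ts i j \<le> B"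
    and len_le: "\<And>i. doc_len Ts i \<le> n" and m_le: "length Ts \<le> n" and d_le: "d \<le> n"
    and tau_le: "tau \<le> n"

text \<open>\<open>G\<close> is a snapshot of the registers below 18, which stay fixed while one
  pattern is matched against one document.\<close>

locale ram_match = ram_input +
  fixes G :: "nat \<Rightarrow> nat" and e st m f N and x y :: "nat \<Rightarrow> nat"
  assumes G: "G 6 = 1" "G 9 = 3" "G 10 = e" "G 11 = st" "G 14 = m" "G 15 = f" "G 17 = N"
    and stm: "st + m \<le> 3 * n" and N: "N \<le> n"
    and x: "x = (\<lambda>q. doc_chr Ts e (st + q))" and y: "y = doc_chr Ts f"
begin

lemma check_loop:
  assumes "\<forall>r<18. R r = G r" "R 18 = j" "R 19 = i" "R 20 = s" "R 21 = p" "R 22 = h"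
    and "R 23 \<le> s" "s + p \<le> max m 1" and "\<forall>t<R 23. x t = x (t + p)"
    and yes: "\<And>R'. \<forall>r<18. R' r = G r \<Longrightarrow> R' 18 = j \<Longrightarrow> R' 19 = i \<Longrightarrow> R' 20 = s \<Longrightarrow> R' 21 = p \<Longrightarrow> R' 22 = h \<Longrightarrow>
       \<forall>t<s. x t = x (t + p) \<Longrightarrow> ok K 74 R'"
    and no: "\<And>R'. \<forall>r<18. R' r = G r \<Longrightarrow> R' 18 = j \<Longrightarrow> R' 19 = i \<Longrightarrow> R' 20 = s \<Longrightarrow> R' 21 = p \<Longrightarrow> R' 22 = h \<Longrightarrow>
       \<not> (\<forall>t<s. x t = x (t + p)) \<Longrightarrow> ok K 78 R'"
  shows "ok (K + 10 * (s - R 23) + 10) 64 R"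
  using assms(1-9)
proof (induction "s - R 23" arbitrary: R rule: less_induct)
  case less
  define t where "t = R 23"
  note R = less.prems(2-6) t_def[symmetric]
  have Rg: "R 6 = 1" "R 10 = e" "R 11 = st" using less.prems(1) G by auto
  have bd: "Suc 0 \<le> B" using B by simp
  show ?case
  proof (cases "t < s")
    case False
    then have ts: "t = s" using less.prems(7) t_def by simp
    have "execs 2 K 64 R"
      using False
      by (simp add: prog_def R bd) (rule yes, use less.prems ts R in auto)
    then show ?thesis by (rule execs_imp_ok) simp
  next
    case True
    have bs: "st + t \<le> B" "st + t + p \<le> B" "t + 1 \<le> B" using True less.prems(8) stm B by auto
    show ?thesis
    proof (cases "x t = x (t + p)")
      case False
      have "execs 8 K 64 R"
        using True False bs
        by (simp add: prog_def R Rg bd chr_le x add.assoc) (rule no, use less.prems True False x in \<open>auto simp: add.assoc\<close>)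
      then show ?thesis by (rule execs_imp_ok) simp
    next
      case eq: True
      have "execs 10 (K + 10 * (s - (t + 1)) + 10) 64 R"
        using True eq bs
        apply (simp add: prog_def R Rg bd chr_le x add.assoc)
        apply (rule less.hyps[THEN ok_mono])
        using less.prems True eq by (auto simp: t_def less_Suc_eq)
      then show ?thesis by (rule execs_imp_ok) (use True in \<open>simp add: t_def\<close>)
    qed
  qed
qed

text \<open>The weight of \<open>j\<close> pays for the letters that a shift makes the algorithm read again.\<close>

definition potential where
  "potential R = 30 * R 18 + 2 * R 19 + 2 * R 20 + R 22" for R :: "nat \<Rightarrow> nat"

definition pattern_inv where
  "pattern_inv R \<longleftrightarrow> (\<forall>r<18. R r = G r) \<and> match_inv x y m N (R 18) (R 19) (R 20) (R 21) (R 22)"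

text \<open>The 12 steps deducted are those already spent between addresses 30 and 61. The potential
  grows by at least \<open>s + 5\<close>, which buys \<open>20 * (s + 5)\<close> steps and covers a
  period test of 10 steps per letter plus the fixed overhead.\<close>

lemma shift_or_reset:
  assumes inv: "pattern_inv R" and mis: "R 19 \<le> R 22" "R 19 < m" "R 18 + R 19 < N" "x (R 19) \<noteq> y (R 18 + R 19)"
    and cont: "\<And>R'. pattern_inv R' \<Longrightarrow> potential R < potential R' \<Longrightarrow> ok (K + 20 * (30 * N + 2 - potential R')) 30 R'"
  shows "ok (K + 20 * (30 * N + 2 - potential R) - 12) 61 R"
proof -
  define j i s p h where v: "j = R 18" "i = R 19" "s = R 20" "p = R 21" "h = R 22"
  note R = v[symmetric]
  have M: "match_inv x y m N j i s p h" and G18: "\<forall>r<18. R r = G r" using inv v unfolding pattern_inv_def by auto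
  note b = match_inv_bounds[OF M]
  have bd: "Suc 0 \<le> B" "3 \<le> B" "0 \<le> B" using B by auto
  have hB: "h \<le> B" "i \<le> B" "j + p \<le> B" "i div 3 + 1 \<le> B" "j + (i div 3 + 1) \<le> B"
    using b stm N B mis v by auto
  have i3: "i + 1 \<le> 3 * (i div 3 + 1)" by presburger
  define L where "L = K + 20 * (30 * N + 2 - potential R) - 12"
  have pot: "potential R = 30 * j + 2 * i + 2 * s + h" by (simp add: potential_def R)
  define LR where "LR = K + 20 * (30 * N + 2 - (30 * (j + (i div 3 + 1)) + 1))"
  have L1: "LR + 10 * s + 30 \<le> L"
  proof -
    define D where "D = i div 3 + 1"
    have "i + 1 \<le> 3 * D" "j + D \<le> N" "s \<le> i" "h \<le> i + 1"
      using i3 b mis v unfolding D_def by auto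
    then have "potential R + (s + 5) \<le> 30 * (j + D) + 1" "30 * (j + D) + 1 \<le> 30 * N + 2"
      unfolding pot by auto
    then have "(30 * N + 2 - (30 * (j + D) + 1)) + (s + 5) \<le> 30 * N + 2 - potential R"
      by linarith
    then show ?thesis unfolding L_def LR_def D_def[symmetric] by linarith
  qed
  have reset: "ok (LR + 8) 78 R'"
    if R': "\<forall>r<18. R' r = G r" "R' 18 = j" "R' 19 = i"
      and ns: "\<not> (s < p \<and> (\<forall>t<s. x t = x (t + p)) \<and> 2 * p \<le> h - s)" for R'
  proof -
    have M': "match_inv x y m N (j + (i div 3 + 1)) 0 0 1 1"
      using match_inv_reset[OF M] mis ns v by auto
    have lt: "30 * j + 2 * i + 2 * s + h < 30 * (j + (i div 3 + 1)) + 1"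
      using i3 b by auto
    have "R' 9 = 3" "R' 6 = 1" using R' G by auto
    then have "execs 8 LR 78 R'"
      using hB bd R'(2,3)
      apply (simp add: prog_def)
      apply (rule cont[THEN ok_mono])
      using R' M' lt by (auto simp: pattern_inv_def potential_def R LR_def)
    then show ?thesis by (rule execs_imp_ok) simp
  qed
  show ?thesis unfolding L_def[symmetric]
  proof (cases "s < p")
    case False
    have "execs 3 (LR + 8) 61 R"
      using False by (simp add: prog_def R bd) (rule reset, use G18 v False in auto)
    then show "ok L 61 R" by (rule execs_imp_ok) (use L1 in linarith)
  next
    case sp: True
    define LS where "LS = K + 20 * (30 * N + 2 - (30 * (j + p) + 2 * (i - p) + 2 * s + (h - p)))"
    \<comment> \<open>The two exits of the period test share one budget, hence the maximum below;
      \<open>LR + 12\<close> allows four instructions at address 74 before a reset.\<close>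
    let ?K = "LR + 12"
    let ?K2 = "max ?K (LS + 8)"
    have "ok (?K2 + 10 * (s - (R(23 := 0, 24 := 1)) 23) + 10) 64 (R(23 := 0, 24 := 1))"
    proof (rule check_loop)
      fix R' assume R': "\<forall>r<18. R' r = G r" "R' 18 = j" "R' 19 = i" "R' 20 = s" "R' 21 = p" "R' 22 = h"
        and per: "\<forall>t<s. x t = x (t + p)"
      show "ok ?K2 74 R'"
      proof (cases "2 * p \<le> h - s")
        case False
        then have sub: "h - (s + p) < p" "h - s \<le> B" "h - (s + p) \<le> B" using hB b by auto
        have "execs 4 (LR + 8) 74 R'"
          using sub by (simp add: prog_def R' bd) (rule reset, use R' False in auto)
        then show ?thesis by (rule execs_imp_ok) simp
      next
        case True
        have sh: "match_inv x y m N (j + p) (i - p) s p (h - p)"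
          using match_inv_shift(1)[OF M _ _ _ sp per True] mis v by auto
        have lt: "30 * j + 2 * i + 2 * s + h < 30 * (j + p) + 2 * (i - p) + 2 * s + (h - p)"
        proof -
          have "i \<le> (i - p) + p" "h \<le> (h - p) + p" by auto
          then show ?thesis using b(3) unfolding distrib_left by linarith
        qed
        have sub: "\<not> h - (s + p) < p" "h - s \<le> B" "h - (s + p) \<le> B" "h - p \<le> B" "i - p \<le> B"
          using True hB b by auto
        have "execs 8 LS 74 R'"
          using sub hB
          apply (simp add: prog_def R' bd)
          apply (rule cont[THEN ok_mono])
          using R' sh lt by (auto simp: pattern_inv_def potential_def R LS_def)
        then show ?thesis by (rule execs_imp_ok) simp
      qed
    next
      fix R' assume R': "\<forall>r<18. R' r = G r" "R' 18 = j" "R' 19 = i" "R' 20 = s" "R' 21 = p" "R' 22 = h"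
        and "\<not> (\<forall>t<s. x t = x (t + p))"
      then show "ok ?K2 78 R'" by (intro reset[THEN ok_mono]) auto
    qed (use G18 b in \<open>auto simp: R\<close>)
    then have "execs 3 (?K2 + 10 * s + 10) 61 R"
      using sp by (simp add: prog_def R bd fun_upd_twist)
    moreover have "?K2 + 10 * s + 10 + 3 \<le> L"
    proof -
      have "LS + 8 + 10 * s + 13 \<le> L"
      proof -
        have "j + i < N" using mis v by simp
        then have "i \<le> (i - p) + p" "h \<le> (h - p) + p" "(j + p) + (i - p) \<le> N" "s \<le> i - p" "h - p \<le> i - p"
          using b by linarith+
        then have "potential R + (s + 5) \<le> 30 * (j + p) + 2 * (i - p) + 2 * s + (h - p)"
            "30 * (j + p) + 2 * (i - p) + 2 * s + (h - p) \<le> 30 * N + 2"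
          using sp b(3) unfolding pot distrib_left by linarith+
        then have "(30 * N + 2 - (30 * (j + p) + 2 * (i - p) + 2 * s + (h - p))) + (s + 5) \<le> 30 * N + 2 - potential R"
          by linarith
        then show ?thesis unfolding L_def LS_def by linarith
      qed
      then show ?thesis using L1 by linarith
    qed
    ultimately show "ok L 61 R" by (rule execs_imp_ok)
  qed
qed

lemma match_loop:
  assumes inv: "pattern_inv R"
    and cont: "\<And>R'. \<forall>r<18. R' r = G r \<Longrightarrow> ok K (if \<exists>j. occ x y m N j then 86 else 87) R'"
  shows "ok (K + 20 * (30 * N + 2 - potential R)) 30 R"
  using inv
proof (induction "30 * N + 2 - potential R" arbitrary: R rule: less_induct)
  case less
  define j i s p h where v: "j = R 18" "i = R 19" "s = R 20" "p = R 21" "h = R 22"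
  note R = v[symmetric]
  have M: "match_inv x y m N j i s p h" and G18: "\<forall>r<18. R r = G r"
    using less.prems v unfolding pattern_inv_def by auto
  have Rg: "R 6 = 1" "R 10 = e" "R 11 = st" "R 14 = m" "R 15 = f" "R 17 = N" using G18 G by auto
  note b = match_inv_bounds[OF M]
  have pot: "potential R = 30 * j + 2 * i + 2 * s + h" by (simp add: potential_def R)
  \<comment> \<open>The extra 1 occurs for \<open>i = 0\<close>, where \<open>h = 1\<close>. One
    unit of \<open>30 * N + 2\<close> thus always remains to pay for the exit.\<close>
  have pN: "potential R \<le> 30 * N + 1" using b unfolding pot by linarith
  define L where "L = K + 20 * (30 * N + 2 - Suc (potential R))"
  have IH: "ok L 30 R'"
    if "pattern_inv R'" "potential R < potential R'" for R'
  proof -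
    have "ok (K + 20 * (30 * N + 2 - potential R')) 30 R'" using less.hyps[OF _ that(1)] that(2) pN by auto
    then show ?thesis by (rule ok_mono) (use that(2) in \<open>auto simp: L_def\<close>)
  qed
  have bd: "Suc 0 \<le> B" "0 \<le> B" using B by auto
  have fin_exit: "ok (K + 20 * (30 * N + 2 - potential R)) 30 R"
    if "execs c K 30 R" "c \<le> 20" for c
    by (rule execs_imp_ok[OF that(1)]) (use pN that in simp)
  have fin_loop: "ok (K + 20 * (30 * N + 2 - potential R)) 30 R"
    if "execs c L 30 R" "c \<le> 20" for c
    by (rule execs_imp_ok[OF that(1)]) (use pN that in \<open>simp add: L_def\<close>)
  show ?case
  proof (cases "h < i")
    case True
    have hB: "st + h \<le> B" "st + h - p \<le> B" "h \<le> B" "Suc h \<le> B" "h - s \<le> B" "(h - s) mod p \<le> B" "Suc (h - (h - s) mod p) \<le> B"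
      "h - (h - s) mod p \<le> B" "p \<le> h" "Suc h - s \<le> B"
      using True b stm B le_trans[OF mod_less_eq_dividend[of "h - s" p], of B] by auto
    consider "x (h - p) < x h" | "x h < x (h - p)" | "x h = x (h - p)" by linarith
    then show ?thesis
    proof cases
      case 1
      note M' = match_inv_greater[OF M True 1]
      have ms: "(h - s) mod p < p" "s + p \<le> h - (h - s) mod p"
      proof -
        show *: "(h - s) mod p < p" using b by simp
        have "0 < (h - s) div p" using b by (simp add: div_greater_zero_iff)
        then have "p \<le> (h - s) div p * p" by simp
        then show "s + p \<le> h - (h - s) mod p" using b div_mult_mod_eq[of "h - s" p] by linarith
      qed
      \<comment> \<open>\<open>s\<close> advances by at least \<open>p\<close> with weight 2, while
        \<open>h\<close> falls back by less than \<open>p\<close>.\<close>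
      have less_mod: "30 * j + 2 * i + 2 * s + h < Suc (30 * j + 2 * i + 2 * (h - (h - s) mod p) + h - (h - s) mod p)"
      proof -
        define u where "u = (h - s) mod p"
        have "u < p" "s + p \<le> h - u" using ms unfolding u_def .
        then show ?thesis unfolding u_def[symmetric] by linarith
      qed
      have "execs 14 L 30 R"
        using 1
        apply (simp add: prog_def R Rg bd chr_le x True hB)
        apply (rule IH)
        using G18 M' less_mod by (auto simp: pattern_inv_def potential_def R)
      then show ?thesis by (rule fin_loop) simp
    next
      case 2
      note M' = match_inv_less[OF M True 2]
      have "execs 13 L 30 R"
        using 2
        apply (simp add: prog_def R Rg bd chr_le x True hB)
        apply (rule IH)
        using G18 M' by (auto simp: pattern_inv_def potential_def R)
      then show ?thesis by (rule fin_loop) simp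
    next
      case 3
      note M' = match_inv_eq[OF M True 3]
      have "execs 11 L 30 R"
        using 3
        apply (simp add: prog_def R Rg bd chr_le x True hB)
        apply (rule IH)
        using G18 M' by (auto simp: pattern_inv_def potential_def R)
      then show ?thesis by (rule fin_loop) simp
    qed
  next
    case hi: False
    show ?thesis
    proof (cases "i < m")
      case False
      then have "occ x y m N j" using match_inv_found M b(2) by (metis le_neq_implies_less)
      then have "execs 4 K 30 R"
        using hi False cont
        apply (simp add: prog_def R Rg bd)
        apply (rule cont[THEN back_subst[of "\<lambda>c. ok K c _"]])
        using G18 by auto
      then show ?thesis by (rule fin_exit) simp
    next
      case im: True
      have jB: "j + i \<le> B" "st + i \<le> B" "Suc i \<le> B" using b N B stm im by auto
      show ?thesis
      proof (cases "j + i < N")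
        case False
        then have "\<not> occ x y m N j'" for j' using match_inv_not_found[OF M] im by auto
        then have "execs 7 K 30 R"
          using hi im False jB
          apply (simp add: prog_def R Rg bd)
          apply (rule cont[THEN back_subst[of "\<lambda>c. ok K c _"]])
          using G18 by auto
        then show ?thesis by (rule fin_exit) simp
      next
        case jN: True
        show ?thesis
        proof (cases "x i = y (j + i)")
          case True
          note M' = match_inv_extend[OF M im jN True]
          have "execs 14 L 30 R"
            using True hi im jN jB
            apply (simp add: prog_def R Rg bd chr_le x y)
            apply (rule IH)
            using G18 M' by (auto simp: pattern_inv_def potential_def R)
          then show ?thesis by (rule fin_loop) simp
        next
          case False
          define L' where "L' = K + 20 * (30 * N + 2 - potential R) - 12"
          have mismatch: "ok L' 61 R'"
            if R': "\<forall>r<23. R' r = R r" for R'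
          proof -
            have pR': "potential R' = potential R" using R' by (simp add: potential_def)
            have "pattern_inv R'" using R' less.prems by (simp add: pattern_inv_def)
            moreover have "R' 19 \<le> R' 22" "R' 19 < m" "R' 18 + R' 19 < N" "x (R' 19) \<noteq> y (R' 18 + R' 19)"
              using hi im jN False R' by (auto simp: R)
            moreover have "ok (K + 20 * (30 * N + 2 - potential R'')) 30 R''"
              if "pattern_inv R''" "potential R' < potential R''" for R''
              using less.hyps[OF _ that(1)] that(2) pN pR' by auto
            ultimately show ?thesis using shift_or_reset[of R' K] pR' unfolding L'_def by simp
          qed
          have "execs 12 L' 30 R"
            using False hi im jN jB
            apply (simp add: prog_def R Rg bd chr_le x y)
            apply (rule mismatch)
            by auto
          then show ?thesis by (rule execs_imp_ok) (use pN in \<open>simp add: L'_def\<close>)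
        qed
      qed
    qed
  qed
qed

end

section \<open>Counting documents and searching for the best pattern\<close>

definition occurs_doc :: "nat list list \<Rightarrow> nat \<Rightarrow> nat \<Rightarrow> nat \<Rightarrow> nat \<Rightarrow> bool" where
  "occurs_doc Ts e st m f \<longleftrightarrow> (\<exists>j. occ (\<lambda>q. doc_chr Ts e (st + q)) (doc_chr Ts f) m (doc_len Ts f) j)"

definition frequent :: "nat list list \<Rightarrow> nat \<Rightarrow> nat \<Rightarrow> nat \<Rightarrow> nat \<Rightarrow> bool" where
  "frequent Ts d e st m \<longleftrightarrow> st + m \<le> doc_len Ts e \<and> d \<le> card {f. f < length Ts \<and> occurs_doc Ts e st m f}"

context ram_input
begin

lemma doc_loop:
  assumes regs: "R 2 = length Ts" "R 6 = 1" "R 9 = 3" and stm: "R 11 + R 14 \<le> 3 * n"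
    and f: "R 15 \<le> length Ts" and cnt: "R 16 = card {f. f < R 15 \<and> occurs_doc Ts (R 10) (R 11) (R 14) f}"
    and cont: "\<And>R'. \<forall>r<15. R' r = R r \<Longrightarrow>
      R' 16 = card {f. f < length Ts \<and> occurs_doc Ts (R 10) (R 11) (R 14) f} \<Longrightarrow> ok K 89 R'"
  shows "ok (K + (\<Sum>f=R 15..<length Ts. 600 * doc_len Ts f + 60) + 2) 22 R"
proof -
  define G where "G = R"
  define occurs where "occurs = occurs_doc Ts (R 10) (R 11) (R 14)"
  have "ok (K + (\<Sum>f=S 15..<length Ts. 600 * doc_len Ts f + 60) + 2) 22 S"
    if "\<forall>r<15. S r = G r" "S 15 \<le> length Ts" "S 16 = card {f. f < S 15 \<and> occurs f}" for S
    using that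
  proof (induction "length Ts - S 15" arbitrary: S rule: less_induct)
    case less
    define f where "f = S 15"
    note S = f_def[symmetric]
    have Sg: "S 2 = length Ts" "S 6 = 1" "S 9 = 3" using less.prems(1) regs unfolding G_def by auto
    have bd: "Suc 0 \<le> B" using B by simp
    show ?case
    proof (cases "f < length Ts")
      case False
      then have fM: "f = length Ts" using less.prems(2) f_def by simp
      have "ok K 89 (S(24 := 0))"
        by (rule cont) (use less.prems fM in \<open>auto simp: S G_def occurs_def\<close>)
      then have "execs 2 K 22 S" using False by (simp add: prog_def S Sg bd)
      then show ?thesis by (rule execs_imp_ok) simp
    next
      case True
      define N where "N = doc_len Ts f"
      define x where "x = (\<lambda>q. doc_chr Ts (R 10) (R 11 + q))"
      define H where "H = G(15 := f, 16 := S 16, 17 := N)"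
      define L where "L = K + (\<Sum>f=Suc f..<length Ts. 600 * doc_len Ts f + 60) + 2"
      interpret ram_match Ts d tau B post n H "R 10" "R 11" "R 14" f N x "doc_chr Ts f"
        by unfold_locales (use regs stm len_le in \<open>auto simp: H_def G_def N_def x_def\<close>)
      have fB: "Suc f \<le> B" "S 16 + 1 \<le> B" "N \<le> B"
      proof -
        have "card {f'. f' < f \<and> occurs f'} \<le> card {..<f}" by (rule card_mono) auto
        then show "Suc f \<le> B" "S 16 + 1 \<le> B" using True B m_le less.prems(3) S by auto
        show "N \<le> B" using N B by simp
      qed
      have occ: "occurs f \<longleftrightarrow> (\<exists>j. occ x (doc_chr Ts f) (R 14) N j)"
        unfolding occurs_def occurs_doc_def x_def N_def ..
      have advance: "ok L 22 S'" if "\<forall>r<15. S' r = G r" "S' 15 = Suc f"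
        "S' 16 = (if occurs f then Suc (S 16) else S 16)" for S'
      proof -
        have *: "{f'. f' < Suc f \<and> occurs f'} = (if occurs f then insert f {f'. f' < f \<and> occurs f'} else {f'. f' < f \<and> occurs f'})"
          by (auto simp: less_Suc_eq)
        have "S' 16 = card {f'. f' < S' 15 \<and> occurs f'}"
          using that less.prems(3) unfolding * that(2) by (simp add: S)
        then have "ok (K + (\<Sum>f=S' 15..<length Ts. 600 * doc_len Ts f + 60) + 2) 22 S'"
          using less.hyps[of S'] that True by (auto simp: S)
        then show ?thesis unfolding L_def that(2) .
      qed
      have after: "ok (L + 3) (if \<exists>j. occ x (doc_chr Ts f) (R 14) N j then 86 else 87) R'"
        if R': "\<forall>r<18. R' r = H r" for R'
      proof -
        have R'v: "\<forall>r<15. R' r = G r" "R' 6 = 1" "R' 15 = f" "R' 16 = S 16"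
          using R' regs by (auto simp: H_def G_def)
        show ?thesis
        proof (cases "occurs f")
          case True
          have "execs 3 L 86 R'"
            using R'v fB apply (simp add: prog_def) apply (rule advance) using True R'v by auto
          then have "ok (L + 3) 86 R'" by (rule execs_imp_ok) simp
          then show ?thesis using True occ by simp
        next
          case False
          have "execs 2 L 87 R'"
            using R'v fB apply (simp add: prog_def) apply (rule advance) using False R'v by auto
          then have "ok (L + 3) 87 R'" by (rule execs_imp_ok) simp
          then show ?thesis using False occ by simp
        qed
      qed
      define T where "T = S(24 := Suc 0, 17 := N, 18 := 0, 19 := 0, 20 := 0, 21 := Suc 0, 22 := Suc 0)"
      have "T r = H r" if "r < 18" for r
      proof -
        have "r < 15 \<or> r = 15 \<or> r = 16 \<or> r = 17" using that by arith
        then show ?thesis using less.prems(1) by (auto simp: T_def H_def S)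
      qed
      then have "pattern_inv T"
        using match_inv_init by (simp add: pattern_inv_def) (simp add: T_def)
      then have "ok (L + 3 + 20 * (30 * N + 2 - potential T)) 30 T"
        by (rule match_loop) (rule after)
      then have "ok (L + 3 + 20 * (30 * N + 2)) 30 T" by (rule ok_mono) simp
      then have "execs 8 (L + 3 + 20 * (30 * N + 2)) 22 S"
        using True fB B by (simp add: prog_def S Sg bd N_def[symmetric] T_def)
      \<comment> \<open>Matching costs \<open>20 * (30 * N + 2) = 600 * N + 40\<close>; the 11
        surrounding instructions fit into the remaining 20.\<close>
      moreover have "L + 3 + 20 * (30 * N + 2) + 8 \<le> K + (\<Sum>f=f..<length Ts. 600 * doc_len Ts f + 60) + 2"
        unfolding L_def using True by (simp add: sum.atLeast_Suc_lessThan N_def)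
      ultimately show ?thesis unfolding f_def by (rule execs_imp_ok)
    qed
  qed
  then show ?thesis using f cnt unfolding G_def occurs_def by auto
qed

end

section \<open>Grid search over starts and lengths\<close>

lemma frequent_mono:
  assumes "frequent Ts d e st m" "m' \<le> m"
  shows "frequent Ts d e st m'"
proof -
  have "occurs_doc Ts e st m' f" if "occurs_doc Ts e st m f" for f
    using that assms(2) unfolding occurs_doc_def occ_def by (meson add_le_mono le_refl less_le_trans order_trans)
  then have "card {f. f < length Ts \<and> occurs_doc Ts e st m f} \<le> card {f. f < length Ts \<and> occurs_doc Ts e st m' f}"
    by (intro card_mono) auto
  then show ?thesis using assms unfolding frequent_def by auto
qed

definition offset :: "nat list list \<Rightarrow> nat \<Rightarrow> nat" where
  "offset Ts e = (\<Sum>e'<e. doc_len Ts e')"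

text \<open>\<open>best\<close> is a position in \<open>concat Ts\<close>; the first disjunct is the
  empty output before any success.\<close>

definition candidate :: "nat list list \<Rightarrow> nat \<Rightarrow> nat \<Rightarrow> nat \<Rightarrow> bool" where
  "candidate Ts d best l \<longleftrightarrow> l = 0 \<and> best = 0 \<or>
     (\<exists>e o'. e < length Ts \<and> best = offset Ts e + o' \<and> frequent Ts d e o' l)"

definition exhausted :: "nat list list \<Rightarrow> nat \<Rightarrow> nat \<Rightarrow> nat \<Rightarrow> nat \<Rightarrow> nat \<Rightarrow> bool" where
  "exhausted Ts d a e o' l \<longleftrightarrow>
     (\<forall>k. (\<forall>e'<e. \<not> frequent Ts d e' (k * a) l) \<and> (k * a < o' \<longrightarrow> \<not> frequent Ts d e (k * a) l))"

text \<open>Longer patterns are rarer, so a start given up for one length need not be revisited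
  after \<open>l\<close> has grown.\<close>

lemma exhausted_mono: "exhausted Ts d a e o' l \<Longrightarrow> l \<le> l' \<Longrightarrow> exhausted Ts d a e o' l'"
  unfolding exhausted_def using frequent_mono by blast

lemma exhausted_next_start:
  assumes "exhausted Ts d a e (k * a) l" "\<not> frequent Ts d e (k * a) l"
  shows "exhausted Ts d a e (k * a + a) l"
proof -
  have "k' * a < k * a \<or> k' = k" if "k' * a < k * a + a" for k'
  proof -
    have "k' * a < Suc k * a" using that by simp
    then have "k' < Suc k" using mult_less_cancel2 by blast
    moreover have "0 < a" using \<open>k' * a < Suc k * a\<close> by (cases a) auto
    ultimately show ?thesis by (auto simp: less_Suc_eq)
  qed
  then show ?thesis using assms unfolding exhausted_def by auto
qed

lemma exhausted_next_doc:
  assumes "exhausted Ts d a e o' l" "doc_len Ts e < o' + l"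
  shows "exhausted Ts d a (Suc e) 0 l"
proof -
  have "\<not> frequent Ts d e (k * a) l" for k
    using assms unfolding exhausted_def frequent_def by (cases "k * a < o'") auto
  then show ?thesis using assms unfolding exhausted_def by (auto simp: less_Suc_eq)
qed

locale ram_outer = ram_input +
  fixes a b :: nat
  assumes ab: "1 \<le> a" "a \<le> b" "b \<le> n" and n_sum: "n = offset Ts (length Ts)"
    and postI: "\<And>R. R 1 \<le> n \<Longrightarrow> candidate Ts d (R 0) (R 1) \<Longrightarrow> exhausted Ts d a (length Ts) 0 (R 1 + b) \<Longrightarrow> post R"
begin

definition outer_inv where
  "outer_inv R \<longleftrightarrow> R 2 = length Ts \<and> R 3 = d \<and> R 4 = a \<and> R 5 = b \<and> R 6 = 1 \<and> R 9 = 3 \<and>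
     R 1 \<le> n \<and> R 10 \<le> length Ts \<and> R 11 \<le> doc_len Ts (R 10) \<and> a dvd R 11 \<and> R 12 = offset Ts (R 10) \<and>
     candidate Ts d (R 0) (R 1) \<and> exhausted Ts d a (R 10) (R 11) (R 1 + b)" for R :: "nat \<Rightarrow> nat"

definition check_cost where
  "check_cost = 660 * n + 20"

text \<open>Failed tests advance the start by \<open>a\<close>, successful ones advance
  \<open>l\<close> by \<open>b\<close>; the quotients bound how many of each can still happen. The
  12 per document pays for moving on, the 3 for leaving.\<close>

definition outer_cost where
  "outer_cost e o' l = check_cost * ((doc_len Ts e - o') div a + (\<Sum>e'=Suc e..<length Ts. doc_len Ts e' div a) + (n - l) div b)
     + 12 * (length Ts - e) + 3"

lemma doc_loop_cost: "(\<Sum>f=0..<length Ts. 600 * doc_len Ts f + 60) \<le> 660 * n"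
proof -
  have "(\<Sum>f=0..<length Ts. 600 * doc_len Ts f + 60) = 600 * n + 60 * length Ts"
    by (simp add: n_sum offset_def sum.distrib sum_distrib_left atLeast0LessThan)
  then show ?thesis using m_le by simp
qed

lemma div_sub_less:
  fixes q u :: nat
  assumes "1 \<le> q" "q \<le> u"
  shows "u div q = Suc ((u - q) div q)"
  using assms by (simp add: le_div_geq)

lemma outer_loop:
  assumes "outer_inv R"
  shows "ok (outer_cost (R 10) (R 11) (R 1)) 9 R"
  using assms
proof (induction "outer_cost (R 10) (R 11) (R 1)" arbitrary: R rule: less_induct)
  case less
  define e o' l off best where v: "e = R 10" "o' = R 11" "l = R 1" "off = R 12" "best = R 0"
  note R = v[symmetric] v(3)[simplified, symmetric]
  have Rg: "R 2 = length Ts" "R 3 = d" "R 4 = a" "R 5 = b" "R 6 = 1" "R 9 = 3"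
    and inv: "l \<le> n" "e \<le> length Ts" "o' \<le> doc_len Ts e" "a dvd o'" "off = offset Ts e"
      "candidate Ts d best l" "exhausted Ts d a e o' (l + b)"
    using less.prems v unfolding outer_inv_def by auto
  have bd: "Suc 0 \<le> B" using B by simp
  show ?case unfolding R
  proof (cases "e < length Ts")
    case False
    then have "e = length Ts" using inv by simp
    then have "post R" using inv by (intro postI) (auto simp: R doc_len_def)
    then have "post (R(24 := 0))" using inv \<open>e = length Ts\<close> by (intro postI) (auto simp: R doc_len_def)
    then have "ok 0 96 (R(24 := 0))" by (rule ok_halt)
    then have "execs 2 0 9 R" using False by (simp add: prog_def R Rg bd)
    then show "ok (outer_cost e o' l) 9 R" by (rule execs_imp_ok) (simp add: outer_cost_def)
  next
    case True
    have off_le: "offset Ts e + doc_len Ts e \<le> n"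
    proof -
      have "offset Ts (Suc e) \<le> offset Ts (length Ts)"
        unfolding offset_def using True by (intro sum_mono2) auto
      then show ?thesis unfolding n_sum by (simp add: offset_def)
    qed
    have len: "doc_len Ts e \<le> n" by (rule len_le)
    have bds: "l + b \<le> B" "o' + (l + b) \<le> B" "off + doc_len Ts e \<le> B" "Suc e \<le> B" "doc_len Ts e \<le> B"
      "off + o' \<le> B" "o' + a \<le> B"
      using inv ab B off_le True m_le len by auto
    show "ok (outer_cost e o' l) 9 R"
    proof (cases "doc_len Ts e < o' + (l + b)")
      case skip: True
      have ex: "exhausted Ts d a (Suc e) 0 (l + b)"
        using exhausted_next_doc[OF inv(7) skip] .
      have cost: "outer_cost (Suc e) 0 l + 11 < outer_cost e o' l"
      proof -
        have "doc_len Ts (Suc e) div a + (\<Sum>e'=Suc (Suc e)..<length Ts. doc_len Ts e' div a)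
            = (\<Sum>e'=Suc e..<length Ts. doc_len Ts e' div a)"
          by (cases "Suc e < length Ts") (auto simp: sum.atLeast_Suc_lessThan doc_len_def)
        then have "check_cost * (doc_len Ts (Suc e) div a + (\<Sum>e'=Suc (Suc e)..<length Ts. doc_len Ts e' div a) + (n - l) div b)
            \<le> check_cost * ((doc_len Ts e - o') div a + (\<Sum>e'=Suc e..<length Ts. doc_len Ts e' div a) + (n - l) div b)"
          by (intro mult_le_mono2) simp
        moreover have "12 * (length Ts - Suc e) + 12 = 12 * (length Ts - e)" using True by simp
        ultimately show ?thesis unfolding outer_cost_def diff_zero by linarith
      qed
      have IH: "ok (outer_cost (Suc e) 0 l) 9 R'"
        if "outer_inv R'" "R' 10 = Suc e" "R' 11 = 0" "R' 1 = l" for R'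
        using less.hyps[OF _ that(1)] cost unfolding that(2-4) R by simp
      have "execs 11 (outer_cost (Suc e) 0 l) 9 R"
        using True skip bds
        apply (simp add: prog_def R Rg bd)
        apply (rule IH)
        using inv ex True by (auto simp: outer_inv_def R Rg offset_def)
      then show ?thesis by (rule execs_imp_ok) (use cost in simp)
    next
      case False
      define cnt where "cnt = card {f. f < length Ts \<and> occurs_doc Ts e o' (l + b) f}"
      obtain k where k: "o' = k * a" using inv(4) by (auto simp: dvd_def mult.commute)
      have freq: "frequent Ts d e o' (l + b) \<longleftrightarrow> d \<le> cnt"
        using False unfolding frequent_def cnt_def by simp
      define L where "L = outer_cost e o' l - check_cost"
      have split_cost: "c < outer_cost e o' l"  "c \<le> L" if "c + check_cost \<le> outer_cost e o' l" for c
        using that unfolding L_def check_cost_def by auto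
      have suc_cost: "outer_cost e o' (l + b) + check_cost \<le> outer_cost e o' l"
      proof -
        have "l + b \<le> n" using False len by simp
        then have "(n - l) div b = Suc ((n - (l + b)) div b)"
          using div_sub_less[of b "n - l"] ab by auto
        then show ?thesis unfolding outer_cost_def by (simp add: algebra_simps)
      qed
      have fail_cost: "outer_cost e (o' + a) l + check_cost \<le> outer_cost e o' l"
      proof -
        \<comment> \<open>The tested pattern fits and has length at least \<open>b \<ge> a\<close>,
          so at least \<open>a\<close> letters remain and the quotient really drops.\<close>
        have "(doc_len Ts e - o') div a = Suc ((doc_len Ts e - (o' + a)) div a)"
          using div_sub_less[of a "doc_len Ts e - o'"] ab False by auto
        then show ?thesis unfolding outer_cost_def by (simp add: algebra_simps)
      qed
      define M where "M = (\<Sum>f=0..<length Ts. 600 * doc_len Ts f + 60)"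
      define S where "S = R(24 := 0, 13 := doc_len Ts e, 14 := l + b, 24 := 0, 15 := 0, 16 := 0)"
      have counted: "ok (L + 5) 89 S'"
        if S': "\<forall>r<15. S' r = S r" "S' 16 = cnt" for S'
      proof -
        have S'v: "S' 2 = length Ts" "S' 3 = d" "S' 4 = a" "S' 5 = b" "S' 6 = 1" "S' 9 = 3"
            "S' 10 = e" "S' 11 = o'" "S' 1 = l" "S' (Suc 0) = l" "S' 12 = off" "S' 0 = best"
          using S' by (auto simp: S_def R Rg)
        show ?thesis
        proof (cases "d \<le> cnt")
          case True
          then have fr: "frequent Ts d e o' (l + b)" using freq by simp
          have IH: "ok L 9 R'"
            if "outer_inv R'" "R' 10 = e" "R' 11 = o'" "R' 1 = l + b" for R'
            using less.hyps[OF _ that(1)] split_cost[OF suc_cost] unfolding that(2-4) R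
            by (auto intro: ok_mono)
          have cand: "candidate Ts d (off + o') (l + b)"
            unfolding candidate_def using fr inv(5) \<open>e < length Ts\<close> by blast
          have "exhausted Ts d a e o' (l + b + b)" using exhausted_mono[OF inv(7)] by simp
          then have "execs 5 L 89 S'"
            using True bds False len
            apply (simp add: prog_def S'v bd S'(2))
            apply (rule IH)
            using inv cand by (auto simp: outer_inv_def S'v)
          then show ?thesis by (rule execs_imp_ok) simp
        next
          case less: False
          have IH: "ok L 9 R'"
            if "outer_inv R'" "R' 10 = e" "R' 11 = o' + a" "R' 1 = l" for R'
            using less.hyps[OF _ that(1)] split_cost[OF fail_cost] unfolding that(2-4) R
            by (auto intro: ok_mono)
          have "exhausted Ts d a e (o' + a) (l + b)"
            using exhausted_next_start inv(7) less freq unfolding k by blast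
          then have "execs 4 L 89 S'"
            using less bds False ab
            apply (simp add: prog_def S'v bd S'(2))
            apply (rule IH)
            using inv by (auto simp: outer_inv_def S'v)
          then show ?thesis by (rule execs_imp_ok) simp
        qed
      qed
      have "ok (L + 5 + M + 2) 22 S"
        using doc_loop[of S "L + 5"] counted Rg inv len False B
        by (auto simp: S_def R cnt_def M_def)
      then have "execs 9 (L + 5 + M + 2) 9 R"
        using True False bds
        by (simp add: prog_def R Rg bd S_def fun_upd_twist)
      moreover have "L + 5 + M + 2 + 9 \<le> outer_cost e o' l"
        using doc_loop_cost fail_cost unfolding L_def M_def check_cost_def by linarith
      ultimately show ?thesis by (rule execs_imp_ok)
    qed
  qed
qed

end

section \<open>From occurrences to substrings of documents\<close>

lemma sublist_iff_occurrence:
  "sublist s t \<longleftrightarrow> (\<exists>j. j + length s \<le> length t \<and> (\<forall>q<length s. s ! q = t ! (j + q)))"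
proof
  assume "sublist s t"
  then obtain ps ss where t: "t = ps @ s @ ss" unfolding sublist_def by blast
  show "\<exists>j. j + length s \<le> length t \<and> (\<forall>q<length s. s ! q = t ! (j + q))"
    unfolding t by (intro exI[of _ "length ps"]) (auto simp: nth_append)
next
  assume "\<exists>j. j + length s \<le> length t \<and> (\<forall>q<length s. s ! q = t ! (j + q))"
  then obtain j where j: "j + length s \<le> length t" "\<forall>q<length s. s ! q = t ! (j + q)" by blast
  then have "s = take (length s) (drop j t)" by (intro nth_equalityI) auto
  then show "sublist s t" by (metis sublist_take sublist_drop sublist_order.order.trans)
qed

lemma occurs_doc_iff:
  assumes "e < length Ts" "st + m \<le> length (Ts ! e)" "f < length Ts"
  shows "occurs_doc Ts e st m f \<longleftrightarrow> sublist (take m (drop st (Ts ! e))) (Ts ! f)"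
  unfolding occurs_doc_def occ_def sublist_iff_occurrence using assms
  by (intro ex_cong1) (auto simp: doc_len_def doc_chr_def)

lemma frequent_iff:
  assumes "e < length Ts"
  shows "frequent Ts d e st m \<longleftrightarrow> st + m \<le> length (Ts ! e) \<and> occurs_in_at_least d Ts (take m (drop st (Ts ! e)))"
proof (cases "st + m \<le> length (Ts ! e)")
  case True
  then have "{f. f < length Ts \<and> occurs_doc Ts e st m f} =
      {i. i < length Ts \<and> sublist (take m (drop st (Ts ! e))) (Ts ! i)}"
    using occurs_doc_iff[OF assms] by auto
  then show ?thesis using assms True by (simp add: frequent_def occurs_in_at_least_def doc_len_def)
qed (use assms in \<open>simp add: frequent_def doc_len_def\<close>)

lemma offset_0: "offset Ts 0 = 0"
  by (simp add: offset_def)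

lemma offset_Cons: "offset (T # Ts) (Suc e) = length T + offset Ts e"
proof -
  have "doc_len (T # Ts) (Suc i) = doc_len Ts i" for i by (simp add: doc_len_def)
  then show ?thesis unfolding offset_def by (subst sum.lessThan_Suc_shift) (simp add: doc_len_def)
qed

lemma offset_length: "offset Ts (length Ts) = sum_list (map length Ts)"
  by (induction Ts) (simp_all add: offset_Cons offset_0)

lemma take_drop_concat:
  assumes "e < length Ts" "st + m \<le> length (Ts ! e)"
  shows "take m (drop (offset Ts e + st) (concat Ts)) = take m (drop st (Ts ! e)) \<and>
    offset Ts e + st + m \<le> length (concat Ts)"
  using assms
proof (induction Ts arbitrary: e)
  case (Cons T Ts)
  show ?case
  proof (cases e)
    case 0
    then show ?thesis using Cons.prems by (simp add: offset_0)
  next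
    case (Suc e')
    then show ?thesis using Cons.IH[of e'] Cons.prems by (simp add: offset_Cons add.assoc)
  qed
qed simp

lemma doc_len_le: "doc_len Ts i \<le> sum_list (map length Ts)"
  by (auto simp: doc_len_def intro: member_le_sum_list)

lemma occurs_in_at_least_sublist:
  assumes "occurs_in_at_least d Ts s" "sublist s' s"
  shows "occurs_in_at_least d Ts s'"
proof -
  have "card {i. i < length Ts \<and> sublist s (Ts ! i)} \<le> card {i. i < length Ts \<and> sublist s' (Ts ! i)}"
    using assms(2) by (intro card_mono) (auto intro: sublist_order.order.trans)
  then show ?thesis using assms(1) unfolding occurs_in_at_least_def by simp
qed

text \<open>A longer string leaves room to round its start up to a multiple of \<open>a\<close>,
  losing at most \<open>a - 1\<close> letters, and still contains a grid pattern of length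
  \<open>l + b\<close>, which would then be frequent.\<close>

lemma exhausted_imp_short:
  assumes ex: "exhausted Ts d a (length Ts) 0 (l + b)" and a: "1 \<le> a" and d: "1 \<le> d"
    and s: "occurs_in_at_least d Ts s"
  shows "length s + 1 < l + a + b"
proof (rule ccontr)
  assume long: "\<not> length s + 1 < l + a + b"
  have "{i. i < length Ts \<and> sublist s (Ts ! i)} \<noteq> {}"
    using s d unfolding occurs_in_at_least_def by (intro notI) simp
  then obtain e ps ss where e: "e < length Ts" "Ts ! e = ps @ s @ ss" by (auto simp: sublist_def)
  \<comment> \<open>Division rounded up: \<open>k * a\<close> is the first grid position not before
    this occurrence of \<open>s\<close>.\<close>
  define k where "k = (length ps + a - 1) div a"
  have k: "length ps \<le> k * a" "k * a + 1 \<le> length ps + a"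
  proof -
    have "(length ps + a - 1) mod a < a" using a by simp
    then show "length ps \<le> k * a" "k * a + 1 \<le> length ps + a"
      using div_mult_mod_eq[of "length ps + a - 1" a] a unfolding k_def by linarith+
  qed
  define r where "r = k * a - length ps"
  have r: "k * a = length ps + r" "r + (l + b) \<le> length s" using k long unfolding r_def by auto
  have "take (l + b) (drop (k * a) (Ts ! e)) = take (l + b) (drop r s)"
    using r by (simp add: e(2))
  moreover have "sublist (take (l + b) (drop r s)) s"
    by (metis sublist_take sublist_drop sublist_order.order.trans)
  ultimately have "occurs_in_at_least d Ts (take (l + b) (drop (k * a) (Ts ! e)))"
    using occurs_in_at_least_sublist[OF s] by simp
  then have "frequent Ts d e (k * a) (l + b)"
    using frequent_iff[OF e(1)] r e(2) by simp
  then show False using ex e(1) unfolding exhausted_def by blast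
qed

lemma occurs_in_at_least_Nil: "d \<le> length Ts \<Longrightarrow> occurs_in_at_least d Ts []"
  by (simp add: occurs_in_at_least_def)

text \<open>The bound makes the set of lengths finite and the empty string makes it nonempty, so
  \<open>Max\<close> is attained.\<close>

lemma lcs_len_less:
  assumes "d \<le> length Ts" "\<And>s. occurs_in_at_least d Ts s \<Longrightarrow> length s < k"
  shows "lcs_len d Ts < k"
proof -
  let ?A = "{length s | s. occurs_in_at_least d Ts s}"
  have "?A \<subseteq> {..<k}" using assms(2) by auto
  moreover from this have "finite ?A" by (rule finite_subset) simp
  moreover have "?A \<noteq> {}" using occurs_in_at_least_Nil[OF assms(1)] by blast
  ultimately have "Max ?A \<in> {..<k}" using Max_in by blast
  then show ?thesis by (simp add: lcs_len_def)
qed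

lemma candidate_correct:
  assumes "d \<le> length Ts" "candidate Ts d best l"
  defines "s \<equiv> take l (drop best (concat Ts))"
  shows "occurs_in_at_least d Ts s" "length s = l" "best + l \<le> length (concat Ts)"
proof -
  have "occurs_in_at_least d Ts s \<and> length s = l \<and> best + l \<le> length (concat Ts)"
  proof (cases "l = 0 \<and> best = 0")
    case True
    then show ?thesis using occurs_in_at_least_Nil[OF assms(1)] by (simp add: s_def)
  next
    case False
    then obtain e st where e: "e < length Ts" "best = offset Ts e + st" "frequent Ts d e st l"
      using assms(2) unfolding candidate_def by blast
    then show ?thesis using frequent_iff[OF e(1)] take_drop_concat[OF e(1), of st l]
      by (auto simp: s_def)
  qed
  then show "occurs_in_at_least d Ts s" "length s = l" "best + l \<le> length (concat Ts)" by auto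
qed

section \<open>Start-up and total running time\<close>

context ram_outer
begin

lemma program_ok:
  assumes a: "a = (tau + 1) div 2" and b: "b = tau + 1 - a"
  shows "ok (outer_cost 0 0 0 + 9) 0 (\<lambda>_. 0)"
proof -
  have "tau + 1 \<le> B" "a \<le> B" "b \<le> B" "length Ts \<le> B" "d \<le> B" "tau \<le> B" "1 \<le> B" "2 \<le> B" "3 \<le> B"
    using ab B tau_le m_le d_le by auto
  moreover have "ok (outer_cost 0 0 0) (Suc (Suc (Suc (Suc (Suc (Suc (Suc (Suc (Suc 0))))))))) R"
    if "outer_inv R" "R 10 = 0" "R 11 = 0" "R 1 = 0" for R
    using outer_loop[OF that(1)] that(2-4) by (simp add: numeral_eq_Suc)
  note start = this
  ultimately have "execs 9 (outer_cost 0 0 0) 0 (\<lambda>_. 0)"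
    apply (simp add: prog_def a[simplified, symmetric] b[simplified, symmetric])
    apply (rule start)
    by (auto simp: outer_inv_def offset_def candidate_def exhausted_def)
  then show ?thesis by (rule execs_imp_ok) simp
qed

text \<open>Both \<open>a\<close> and \<open>b\<close> are at least \<open>tau / 2\<close>, so there
  are at most \<open>4 * n / tau\<close> tests of at most \<open>680 * n\<close> steps each; after
  multiplication by \<open>tau\<close> the rest adds at most \<open>24 * n ^ 2\<close>.\<close>

lemma outer_cost_bound:
  assumes tau: "tau \<le> 2 * a" and Ts: "Ts \<noteq> []" and n: "1 \<le> n"
  shows "tau * (outer_cost 0 0 0 + 9) \<le> 3000 * n ^ 2"
proof -
  define F where "F = (\<Sum>e<length Ts. doc_len Ts e div a)"
  have F: "doc_len Ts 0 div a + (\<Sum>e=Suc 0..<length Ts. doc_len Ts e div a) = F"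
    using Ts unfolding F_def by (simp add: sum.atLeast_Suc_lessThan flip: atLeast0LessThan)
  have "a * F \<le> n"
    unfolding F_def n_sum offset_def sum_distrib_left by (intro sum_mono) simp
  then have "tau * F \<le> 2 * n" using mult_le_mono1[OF tau, of F] by linarith
  moreover have "tau * (n div b) \<le> 2 * n"
  proof -
    have "tau * (n div b) \<le> (2 * b) * (n div b)" using tau ab by (intro mult_le_mono1) auto
    also have "\<dots> \<le> 2 * n" by simp
    finally show ?thesis .
  qed
  ultimately have "tau * (F + n div b) \<le> 4 * n" by (simp add: distrib_left)
  then have "check_cost * (tau * (F + n div b)) \<le> (680 * n) * (4 * n)"
    by (intro mult_le_mono[of check_cost]) (use n in \<open>simp add: check_cost_def\<close>)
  moreover have "tau * (12 * length Ts + 12) \<le> n * (24 * n)"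
    using tau_le m_le n by (intro mult_le_mono) auto
  ultimately show ?thesis
    unfolding outer_cost_def by (simp add: F algebra_simps power2_eq_square)
qed

end

theorem theorem1:
  "\<exists>P :: instr list. \<forall>c :: nat. \<exists>(C :: real) (K :: nat).
     \<forall>(Ts :: nat list list) (d :: nat) (tau :: nat) (\<sigma> :: nat).
       let n = sum_list (map length Ts) in
       (\<forall>T\<in>set Ts. T \<noteq> [] \<and> set T \<subseteq> {1..\<sigma>}) \<and> \<sigma> \<le> n ^ c \<and>
       2 \<le> d \<and> d \<le> length Ts \<and> 1 \<le> tau \<and> tau \<le> n \<longrightarrow>
       (\<exists>t :: nat.
          halted P (run P Ts d tau t) \<and>
          real t \<le> C * real n ^ 2 / real tau \<and>
          (\<forall>k\<le>t. \<forall>r. snd (run P Ts d tau k) r \<le> (n + 1) ^ K) \<and>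
          (let R = snd (run P Ts d tau t);
               s = take (R 1) (drop (R 0) (concat Ts))
           in R 0 + R 1 \<le> n \<and> occurs_in_at_least d Ts s \<and>
              int (length s) \<ge> int (lcs_len d Ts) - int tau + 1))"
proof (rule exI[of _ prog], intro allI, rule exI[of _ 3000], rule exI, intro allI, unfold Let_def, intro impI, elim conjE)
  fix c d tau \<sigma> :: nat and Ts :: "nat list list"
  define n where "n = sum_list (map length Ts)"
  assume docs: "\<forall>T\<in>set Ts. T \<noteq> [] \<and> set T \<subseteq> {1..\<sigma>}"
    and sigma: "\<sigma> \<le> sum_list (map length Ts) ^ c"
    and d: "2 \<le> d" "d \<le> length Ts" and tau: "1 \<le> tau" "tau \<le> sum_list (map length Ts)"
  \<comment> \<open>The exponent \<open>c\<close> covers the letters, and five further factors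
    \<open>n + 1\<close> dominate \<open>4 * n + 10\<close>.\<close>
  define B where "B = (n + 1) ^ (c + 5)"
  define a where "a = (tau + 1) div 2"
  define b where "b = tau + 1 - a"
  define post where "post = (\<lambda>R :: nat \<Rightarrow> nat. R 0 + R 1 \<le> n \<and>
     occurs_in_at_least d Ts (take (R 1) (drop (R 0) (concat Ts))) \<and>
     int (length (take (R 1) (drop (R 0) (concat Ts)))) \<ge> int (lcs_len d Ts) - int tau + 1)"
  have steps: "1 \<le> a" "a \<le> b" "b \<le> tau" "a + b = tau + 1" "tau \<le> 2 * a"
    using tau unfolding a_def b_def by auto
  have m_le: "length Ts \<le> n"
  proof -
    have "sum_list (map (\<lambda>_. 1) Ts) \<le> n"
      unfolding n_def using docs by (intro sum_list_mono) (auto simp: Suc_le_eq)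
    then show ?thesis by (simp add: sum_list_triv)
  qed
  have n2: "2 \<le> n" using m_le d by simp
  have B_ge: "4 * n + 10 \<le> B"
  proof -
    have "2 ^ 4 \<le> (n + 1) ^ 4" using n2 by (intro power_mono) auto
    also have "\<dots> \<le> (n + 1) ^ (c + 4)" by (intro power_increasing) auto
    finally have "16 * (n + 1) \<le> (n + 1) ^ (c + 4) * (n + 1)" by (intro mult_le_mono1) simp
    also have "\<dots> = (n + 1) ^ Suc (c + 4)" by (simp only: power_Suc2)
    also have "\<dots> = B" by (simp add: B_def eval_nat_numeral)
    finally show ?thesis by simp
  qed
  have chr: "doc_chr Ts i j \<le> B" for i j
  proof (cases "i < length Ts \<and> j < length (Ts ! i)")
    case True
    then have "Ts ! i \<in> set Ts" "Ts ! i ! j \<in> set (Ts ! i)" by auto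
    then have "Ts ! i ! j \<in> {1..\<sigma>}" using docs by blast
    then have "Ts ! i ! j \<le> \<sigma>" by simp
    also have "\<dots> \<le> n ^ c" using sigma n_def by simp
    also have "\<dots> \<le> (n + 1) ^ c" by (intro power_mono) auto
    also have "\<dots> \<le> B" unfolding B_def by (intro power_increasing) auto
    finally show ?thesis using True by (simp add: doc_chr_def)
  qed (auto simp: doc_chr_def)
  have lc: "length (concat Ts) = n" by (simp add: n_def length_concat)
  have post: "post R"
    if "candidate Ts d (R 0) (R 1)" "exhausted Ts d a (length Ts) 0 (R 1 + b)" for R
  proof -
    \<comment> \<open>As \<open>a + b = tau + 1\<close>, the two roundings together cost at most
      \<open>tau - 1\<close> letters.\<close>
    have "length s < R 1 + tau" if "occurs_in_at_least d Ts s" for s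
      using exhausted_imp_short[OF \<open>exhausted Ts d a (length Ts) 0 (R 1 + b)\<close> steps(1) _ that] d steps by auto
    then have "lcs_len d Ts < R 1 + tau" by (rule lcs_len_less[OF d(2)])
    then show ?thesis using candidate_correct[OF d(2) that(1)] lc unfolding post_def by auto
  qed
  interpret ram_outer Ts d tau B post n a b
  proof
    show "doc_len Ts i \<le> n" for i unfolding n_def by (rule doc_len_le)
    show "n = offset Ts (length Ts)" by (simp add: n_def offset_length)
    show "d \<le> n" using d m_le by simp
    show "b \<le> n" "tau \<le> n" using steps tau n_def by auto
  qed (use B_ge chr m_le steps post in auto)
  have "bnd (\<lambda>_. 0)" by (simp add: bnd_def)
  then obtain t where t: "t \<le> outer_cost 0 0 0 + 9" "halted prog (run prog Ts d tau t)"
    "post (snd (run prog Ts d tau t))" "\<forall>k\<le>t. bnd (snd (run prog Ts d tau k))"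
    using program_ok[OF a_def b_def] unfolding ok_def run_def Let_def by blast
  have "tau * t \<le> 3000 * n ^ 2"
  proof (rule order_trans)
    show "tau * t \<le> tau * (outer_cost 0 0 0 + 9)" using t(1) by simp
    show "tau * (outer_cost 0 0 0 + 9) \<le> 3000 * n ^ 2"
      by (rule outer_cost_bound) (use steps d n2 in auto)
  qed
  then have "real (tau * t) \<le> real (3000 * n ^ 2)" by (rule of_nat_mono)
  then have time: "real t \<le> 3000 * real n ^ 2 / real tau"
    using tau by (simp add: field_simps)
  have bounds: "\<forall>k\<le>t. \<forall>r. snd (run prog Ts d tau k) r \<le> (n + 1) ^ (c + 5)"
    using t(4) unfolding bnd_def by (simp add: B_def)
  show "\<exists>t. halted prog (run prog Ts d tau t) \<and>
      real t \<le> 3000 * real (sum_list (map length Ts)) ^ 2 / real tau \<and>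
      (\<forall>k\<le>t. \<forall>r. snd (run prog Ts d tau k) r \<le> (sum_list (map length Ts) + 1) ^ (c + 5)) \<and>
      snd (run prog Ts d tau t) 0 + snd (run prog Ts d tau t) 1 \<le> sum_list (map length Ts) \<and>
      occurs_in_at_least d Ts (take (snd (run prog Ts d tau t) 1) (drop (snd (run prog Ts d tau t) 0) (concat Ts))) \<and>
      int (lcs_len d Ts) - int tau + 1
        \<le> int (length (take (snd (run prog Ts d tau t) 1) (drop (snd (run prog Ts d tau t) 0) (concat Ts))))"
    unfolding n_def[symmetric]
    by (intro exI[of _ t] conjI t(2) time bounds t(3)[unfolded post_def, THEN conjunct1]
        t(3)[unfolded post_def, THEN conjunct2, THEN conjunct1] t(3)[unfolded post_def, THEN conjunct2, THEN conjunct2])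
qed

end
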